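(* Let $(\mathbf{M}^n,g(t),H(t))$, $t\in[0,T]$, be a solution of the generalized Ricci flow on an $n$-dimensional closed manifold $\mathbf{M}$. Let $u:\mathbf{M}\times[0,T]\to\mathbb{R}$ be a smooth positive solution of the heat equation $\partial_t u=\Delta_{g(t)}u$, and let $A=\max_{\mathbf{M}}u(\cdot,0)$. Then for all $(x,t)\in\mathbf{M}\times(0,T]$, $$|\nabla u|^2\le \frac{u^2}{t}\ln\left(\frac{A}{u}\right).$$
   Context: Closed means compact without boundary. A solution of the generalized Ricci flow on $\mathbf{M}$ is a smooth one-parameter family $(g(t),H(t))$ of Riemannian metrics $g(t)$ and closed three-forms $H(t)$ on $\mathbf{M}$ with $$\partial_t g=-2\,\mathrm{Ric}+\tfrac12H^2,\qquad \partial_t H=-d\,d^*_gH,$$ where $\mathrm{Ric}$ is the Ricci tensor of $g(t)$, $d^*_g$ is the adjoint of the exterior derivative $d$ with respect to $g(t)$, and $H^2$ is the positive semidefinite symmetric 2-tensor $H^2(X,Y)=\langle i_XH,i_YH\rangle_{g(t)}$, with $i_X$ the interior product (in index notation $H^2_{ij}=g^{kl}g^{pq}H_{ikp}H_{jlq}$). The gradient, its norm and the Laplacian $\Delta_{g(t)}=\mathrm{tr}_{g(t)}\nabla^2_{g(t)}$ are taken with respect to $g(t)$. *)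

theory Defs
  imports "HOL-Analysis.Analysis"
begin

section \<open>Smooth maps\<close>

text \<open>
  Derivatives are taken within \<open>S\<close>. This is used for open \<open>S\<close> and for \<open>S = V \<times> {0..T}\<close> with \<open>V\<close>
  open and \<open>T > 0\<close>, i.e. smoothness up to the two time ends; in both cases the derivative within
  \<open>S\<close> is unique.
\<close>

primrec ck_on ::
  "nat \<Rightarrow> 'a::real_normed_vector set \<Rightarrow> ('a \<Rightarrow> 'b::real_normed_vector) \<Rightarrow> bool" where
  "ck_on 0 S f \<longleftrightarrow> continuous_on S f"
| "ck_on (Suc k) S f \<longleftrightarrow>
     (\<forall>x\<in>S. f differentiable (at x within S)) \<and>
     (\<forall>v. ck_on k S (\<lambda>x. frechet_derivative f (at x within S) v))"

definition smooth_on ::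
  "'a::real_normed_vector set \<Rightarrow> ('a \<Rightarrow> 'b::real_normed_vector) \<Rightarrow> bool" where
  "smooth_on S f \<longleftrightarrow> (\<forall>k. ck_on k S f)"

definition pd :: "'n \<Rightarrow> (real^'n \<Rightarrow> real) \<Rightarrow> real^'n \<Rightarrow> real" where
  "pd i f y = frechet_derivative f (at y) (axis i 1)"


section \<open>Closed manifolds\<close>

type_synonym ('a, 'n) chart = "'a set \<times> ('a \<Rightarrow> (real, 'n) vec)"

definition chart_image :: "('a, 'n::finite) chart \<Rightarrow> (real^'n) set" where
  "chart_image c = snd c ` fst c"

definition chart_inv :: "('a, 'n::finite) chart \<Rightarrow> real^'n \<Rightarrow> 'a" where
  "chart_inv c = inv_into (fst c) (snd c)"

definition is_chart :: "'a topology \<Rightarrow> ('a, 'n::finite) chart \<Rightarrow> bool" where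
  "is_chart X c \<longleftrightarrow>
     openin X (fst c) \<and> open (chart_image c) \<and>
     homeomorphic_map (subtopology X (fst c)) (top_of_set (chart_image c)) (snd c)"

definition transition :: "('a, 'n::finite) chart \<Rightarrow> ('a, 'n) chart \<Rightarrow> real^'n \<Rightarrow> real^'n" where
  "transition c d = snd d \<circ> chart_inv c"

text \<open>
  The charts map onto open subsets of \<open>real^'n\<close>, so there is no boundary. The atlas need not be
  maximal, and the manifold need not be connected.
\<close>

definition closed_manifold :: "'a topology \<Rightarrow> ('a, 'n::finite) chart set \<Rightarrow> bool" where
  "closed_manifold X \<A> \<longleftrightarrow>
     compact_space X \<and> Hausdorff_space X \<and> second_countable X \<and>
     (\<forall>c\<in>\<A>. is_chart X c) \<and> (\<Union>c\<in>\<A>. fst c) = topspace X \<and>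
     (\<forall>c\<in>\<A>. \<forall>d\<in>\<A>. smooth_on (snd c ` (fst c \<inter> fst d)) (transition c d))"

definition local_rep :: "('a \<Rightarrow> 'b) \<Rightarrow> ('a, 'n::finite) chart \<Rightarrow> real^'n \<Rightarrow> 'b" where
  "local_rep f c = f \<circ> chart_inv c"

text \<open>Joint smoothness in space and time of a family, given by its local expressions in the charts.\<close>

definition smooth_family ::
  "('a, 'n::finite) chart set \<Rightarrow> real \<Rightarrow>
   (real \<Rightarrow> ('a, 'n) chart \<Rightarrow> real^'n \<Rightarrow> 'b::real_normed_vector) \<Rightarrow> bool" where
  "smooth_family \<A> T F \<longleftrightarrow>
     (\<forall>c\<in>\<A>. smooth_on (chart_image c \<times> {0..T}) (\<lambda>(y, t). F t c y))"


section \<open>Tensor fields\<close>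

text \<open>
  A covariant tensor field is given by its components in each chart of the atlas, as functions of
  the coordinates, related on overlaps by the tensor transformation law. Values outside
  the chart images are irrelevant.
\<close>

type_synonym ('a, 'n) tensor2 = "('a, 'n) chart \<Rightarrow> (real, 'n) vec \<Rightarrow> ((real, 'n) vec, 'n) vec"
type_synonym ('a, 'n) tensor3 =
  "('a, 'n) chart \<Rightarrow> (real, 'n) vec \<Rightarrow> (((real, 'n) vec, 'n) vec, 'n) vec"

definition jacobian ::
  "('a, 'n::finite) chart \<Rightarrow> ('a, 'n) chart \<Rightarrow> real^'n \<Rightarrow> 'n \<Rightarrow> 'n \<Rightarrow> real" where
  "jacobian c d y k i = pd i (\<lambda>z. transition c d z $ k) y"

definition tensor2_field :: "('a, 'n::finite) chart set \<Rightarrow> ('a, 'n) tensor2 \<Rightarrow> bool" where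
  "tensor2_field \<A> S \<longleftrightarrow>
     (\<forall>c\<in>\<A>. smooth_on (chart_image c) (S c)) \<and>
     (\<forall>c\<in>\<A>. \<forall>d\<in>\<A>. \<forall>p\<in>fst c \<inter> fst d. \<forall>i j.
        S c (snd c p) $ i $ j =
        (\<Sum>k\<in>UNIV. \<Sum>l\<in>UNIV. jacobian c d (snd c p) k i * jacobian c d (snd c p) l j *
           S d (snd d p) $ k $ l))"

definition tensor3_field :: "('a, 'n::finite) chart set \<Rightarrow> ('a, 'n) tensor3 \<Rightarrow> bool" where
  "tensor3_field \<A> S \<longleftrightarrow>
     (\<forall>c\<in>\<A>. smooth_on (chart_image c) (S c)) \<and>
     (\<forall>c\<in>\<A>. \<forall>d\<in>\<A>. \<forall>p\<in>fst c \<inter> fst d. \<forall>i j m.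
        S c (snd c p) $ i $ j $ m =
        (\<Sum>k\<in>UNIV. \<Sum>l\<in>UNIV. \<Sum>q\<in>UNIV.
           jacobian c d (snd c p) k i * jacobian c d (snd c p) l j * jacobian c d (snd c p) q m *
           S d (snd d p) $ k $ l $ q))"

definition riemannian_metric :: "('a, 'n::finite) chart set \<Rightarrow> ('a, 'n) tensor2 \<Rightarrow> bool" where
  "riemannian_metric \<A> G \<longleftrightarrow> tensor2_field \<A> G \<and>
     (\<forall>c\<in>\<A>. \<forall>y\<in>chart_image c.
        (\<forall>i j. G c y $ i $ j = G c y $ j $ i) \<and> (\<forall>v. v \<noteq> 0 \<longrightarrow> v \<bullet> (G c y *v v) > 0))"

definition two_form :: "('a, 'n::finite) chart set \<Rightarrow> ('a, 'n) tensor2 \<Rightarrow> bool" where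
  "two_form \<A> S \<longleftrightarrow> tensor2_field \<A> S \<and>
     (\<forall>c\<in>\<A>. \<forall>y\<in>chart_image c. \<forall>i j. S c y $ i $ j = - S c y $ j $ i)"

definition three_form :: "('a, 'n::finite) chart set \<Rightarrow> ('a, 'n) tensor3 \<Rightarrow> bool" where
  "three_form \<A> S \<longleftrightarrow> tensor3_field \<A> S \<and>
     (\<forall>c\<in>\<A>. \<forall>y\<in>chart_image c. \<forall>i j k.
        S c y $ i $ j $ k = - S c y $ j $ i $ k \<and> S c y $ i $ j $ k = - S c y $ i $ k $ j)"

definition ext_deriv2 :: "(real^'n \<Rightarrow> real^'n^'n) \<Rightarrow> real^'n \<Rightarrow> real^'n^'n^'n" where
  "ext_deriv2 \<alpha> y = (\<chi> i j k.
     pd i (\<lambda>z. \<alpha> z $ j $ k) y - pd j (\<lambda>z. \<alpha> z $ i $ k) y + pd k (\<lambda>z. \<alpha> z $ i $ j) y)"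

definition ext_deriv3 :: "(real^'n \<Rightarrow> real^'n^'n^'n) \<Rightarrow> real^'n \<Rightarrow> real^'n^'n^'n^'n" where
  "ext_deriv3 \<eta> y = (\<chi> i j k l.
     pd i (\<lambda>z. \<eta> z $ j $ k $ l) y - pd j (\<lambda>z. \<eta> z $ i $ k $ l) y
     + pd k (\<lambda>z. \<eta> z $ i $ j $ l) y - pd l (\<lambda>z. \<eta> z $ i $ j $ k) y)"

definition closed_three_form :: "('a, 'n::finite) chart set \<Rightarrow> ('a, 'n) tensor3 \<Rightarrow> bool" where
  "closed_three_form \<A> S \<longleftrightarrow> three_form \<A> S \<and>
     (\<forall>c\<in>\<A>. \<forall>y\<in>chart_image c. ext_deriv3 (S c) y = 0)"


section \<open>Riemannian geometry in coordinates\<close>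

text \<open>Here \<open>G\<close> is the component matrix of a metric in one chart, as a function of the coordinates.\<close>

definition ginv :: "(real^'n \<Rightarrow> real^'n^'n) \<Rightarrow> real^'n \<Rightarrow> 'n \<Rightarrow> 'n \<Rightarrow> real" where
  "ginv G y i j = matrix_inv (G y) $ i $ j"

definition christoffel ::
  "(real^'n \<Rightarrow> real^'n^'n) \<Rightarrow> 'n \<Rightarrow> 'n \<Rightarrow> 'n \<Rightarrow> real^'n \<Rightarrow> real" where
  "christoffel G k i j y = (1/2) * (\<Sum>l\<in>UNIV. ginv G y k l *
     (pd i (\<lambda>z. G z $ j $ l) y + pd j (\<lambda>z. G z $ i $ l) y - pd l (\<lambda>z. G z $ i $ j) y))"

definition ricci :: "(real^'n \<Rightarrow> real^'n^'n) \<Rightarrow> real^'n \<Rightarrow> real^'n^'n" where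
  "ricci G y = (\<chi> i j.
     (\<Sum>k\<in>UNIV. pd k (christoffel G k i j) y - pd j (christoffel G k i k) y) +
     (\<Sum>k\<in>UNIV. \<Sum>l\<in>UNIV.
        christoffel G k k l y * christoffel G l i j y - christoffel G k j l y * christoffel G l i k y))"

definition three_form_sq ::
  "(real^'n \<Rightarrow> real^'n^'n) \<Rightarrow> (real^'n \<Rightarrow> real^'n^'n^'n) \<Rightarrow> real^'n \<Rightarrow> real^'n^'n" where
  "three_form_sq G \<eta> y = (\<chi> i j.
     \<Sum>k\<in>UNIV. \<Sum>l\<in>UNIV. \<Sum>p\<in>UNIV. \<Sum>q\<in>UNIV.
       ginv G y k l * ginv G y p q * \<eta> y $ i $ k $ p * \<eta> y $ j $ l $ q)"

definition gradient :: "(real^'n \<Rightarrow> real^'n^'n) \<Rightarrow> (real^'n \<Rightarrow> real) \<Rightarrow> real^'n \<Rightarrow> real^'n" where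
  "gradient G f y = (\<chi> i. \<Sum>j\<in>UNIV. ginv G y i j * pd j f y)"

definition metric_norm :: "(real^'n \<Rightarrow> real^'n^'n) \<Rightarrow> real^'n \<Rightarrow> real^'n \<Rightarrow> real" where
  "metric_norm G y v = sqrt (\<Sum>i\<in>UNIV. \<Sum>j\<in>UNIV. G y $ i $ j * v $ i * v $ j)"

definition hessian :: "(real^'n \<Rightarrow> real^'n^'n) \<Rightarrow> (real^'n \<Rightarrow> real) \<Rightarrow> real^'n \<Rightarrow> real^'n^'n" where
  "hessian G f y = (\<chi> i j. pd i (pd j f) y - (\<Sum>k\<in>UNIV. christoffel G k i j y * pd k f y))"

definition laplacian :: "(real^'n \<Rightarrow> real^'n^'n) \<Rightarrow> (real^'n \<Rightarrow> real) \<Rightarrow> real^'n \<Rightarrow> real" where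
  "laplacian G f y = (\<Sum>i\<in>UNIV. \<Sum>j\<in>UNIV. ginv G y i j * hessian G f y $ i $ j)"


section \<open>The adjoint of the exterior derivative\<close>

text \<open>
  The inner products on forms carry the usual factor \<open>1/k!\<close>, so that
  \<open>e\<^sub>i\<^sub>1 \<and> \<dots> \<and> e\<^sub>i\<^sub>k\<close> (\<open>i\<^sub>1 < \<dots> < i\<^sub>k\<close>) is orthonormal for an orthonormal coframe.
  With this normalization the adjoint of \<open>d\<close> is minus the divergence. The tensor
  \<^const>\<open>three_form_sq\<close> uses full contraction without such a factor.
\<close>

definition inner2 :: "(real^'n \<Rightarrow> real^'n^'n) \<Rightarrow> real^'n \<Rightarrow> real^'n^'n \<Rightarrow> real^'n^'n \<Rightarrow> real" where
  "inner2 G y \<alpha> \<beta> = (1/2) * (\<Sum>i\<in>UNIV. \<Sum>j\<in>UNIV. \<Sum>k\<in>UNIV. \<Sum>l\<in>UNIV.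
     ginv G y i k * ginv G y j l * \<alpha> $ i $ j * \<beta> $ k $ l)"

definition inner3 ::
  "(real^'n \<Rightarrow> real^'n^'n) \<Rightarrow> real^'n \<Rightarrow> real^'n^'n^'n \<Rightarrow> real^'n^'n^'n \<Rightarrow> real" where
  "inner3 G y \<alpha> \<beta> = (1/6) *
     (\<Sum>i\<in>UNIV. \<Sum>j\<in>UNIV. \<Sum>m\<in>UNIV. \<Sum>k\<in>UNIV. \<Sum>l\<in>UNIV. \<Sum>q\<in>UNIV.
        ginv G y i k * ginv G y j l * ginv G y m q * \<alpha> $ i $ j $ m * \<beta> $ k $ l $ q)"

text \<open>
  Turns a chart-independent scalar expression in coordinates into a function on the manifold.
\<close>

definition globalize ::
  "('a, 'n::finite) chart set \<Rightarrow> (('a, 'n) chart \<Rightarrow> real^'n \<Rightarrow> real) \<Rightarrow> 'a \<Rightarrow> real" where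
  "globalize \<A> F p = (let c = (SOME c. c \<in> \<A> \<and> p \<in> fst c) in F c (snd c p))"

definition riemannian_volume ::
  "'a topology \<Rightarrow> ('a, 'n::finite) chart set \<Rightarrow> ('a, 'n) tensor2 \<Rightarrow> 'a measure \<Rightarrow> bool" where
  "riemannian_volume X \<A> G \<mu> \<longleftrightarrow>
     space \<mu> = topspace X \<and> sets \<mu> = sigma_sets (topspace X) {U. openin X U} \<and>
     (\<forall>c\<in>\<A>. \<forall>B\<in>sets \<mu>. B \<subseteq> fst c \<longrightarrow>
        emeasure \<mu> B = (\<integral>\<^sup>+ y \<in> snd c ` B. ennreal (sqrt (det (G c y))) \<partial>lborel))"

text \<open>
  \<open>is_codifferential X \<A> G \<eta> \<beta>\<close> says that the two-form \<open>\<beta>\<close> is \<open>d\<^sup>* \<eta>\<close>, where \<open>d\<^sup>*\<close> is the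
  \<open>L\<^sup>2\<close>-adjoint of \<open>d\<close>. It is a relation because \<open>\<beta>\<close> is only determined on the chart images.
\<close>

definition is_codifferential ::
  "'a topology \<Rightarrow> ('a, 'n::finite) chart set \<Rightarrow> ('a, 'n) tensor2 \<Rightarrow> ('a, 'n) tensor3 \<Rightarrow>
   ('a, 'n) tensor2 \<Rightarrow> bool" where
  "is_codifferential X \<A> G \<eta> \<beta> \<longleftrightarrow> two_form \<A> \<beta> \<and>
     (\<exists>\<mu>. riemannian_volume X \<A> G \<mu> \<and>
       (\<forall>\<alpha>. two_form \<A> \<alpha> \<longrightarrow>
         (\<integral>p. globalize \<A> (\<lambda>c y. inner3 (G c) y (ext_deriv2 (\<alpha> c) y) (\<eta> c y)) p \<partial>\<mu>) =
         (\<integral>p. globalize \<A> (\<lambda>c y. inner2 (G c) y (\<alpha> c y) (\<beta> c y)) p \<partial>\<mu>)))"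


section \<open>Generalized Ricci flow and heat equation\<close>

definition generalized_ricci_flow ::
  "'a topology \<Rightarrow> ('a, 'n::finite) chart set \<Rightarrow> real \<Rightarrow>
   (real \<Rightarrow> ('a, 'n) tensor2) \<Rightarrow> (real \<Rightarrow> ('a, 'n) tensor3) \<Rightarrow> bool" where
  "generalized_ricci_flow X \<A> T g H \<longleftrightarrow>
     smooth_family \<A> T g \<and> smooth_family \<A> T H \<and>
     (\<forall>t\<in>{0..T}. riemannian_metric \<A> (g t) \<and> closed_three_form \<A> (H t)) \<and>
     (\<forall>t\<in>{0..T}. \<forall>c\<in>\<A>. \<forall>y\<in>chart_image c.
        ((\<lambda>s. g s c y) has_vector_derivative
           (- 2 *\<^sub>R ricci (g t c) y + (1/2) *\<^sub>R three_form_sq (g t c) (H t c) y))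
          (at t within {0..T})) \<and>
     (\<forall>t\<in>{0..T}. \<exists>\<beta>. is_codifferential X \<A> (g t) (H t) \<beta> \<and>
        (\<forall>c\<in>\<A>. \<forall>y\<in>chart_image c.
           ((\<lambda>s. H s c y) has_vector_derivative - ext_deriv2 (\<beta> c) y) (at t within {0..T})))"

definition heat_solution ::
  "('a, 'n::finite) chart set \<Rightarrow> real \<Rightarrow> (real \<Rightarrow> ('a, 'n) tensor2) \<Rightarrow> (real \<Rightarrow> 'a \<Rightarrow> real) \<Rightarrow> bool"
  where
  "heat_solution \<A> T g u \<longleftrightarrow>
     smooth_family \<A> T (\<lambda>t. local_rep (u t)) \<and>
     (\<forall>t\<in>{0..T}. \<forall>c\<in>\<A>. \<forall>p\<in>fst c.
        ((\<lambda>s. u s p) has_real_derivative laplacian (g t c) (local_rep (u t) c) (snd c p))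
          (at t within {0..T}))"

end

theory Submission
  imports Defs
begin

text \<open>
  The estimate is a Bochner argument for \<open>f = ln (A / u)\<close>. Since \<open>u\<close> solves the heat equation,
  \<open>\<partial>\<^sub>t f = \<Delta> f - |\<nabla>f|\<^sup>2\<close>, and since \<open>|\<nabla>f|\<^sup>2 = |\<nabla>u|\<^sup>2 / u\<^sup>2\<close> the claim is \<open>\<Psi> \<le> 0\<close> for
  \<open>\<Psi> = t |\<nabla>f|\<^sup>2 - f\<close>.

  The time derivative of \<open>|\<nabla>f|\<^sup>2 = g\<^sup>i\<^sup>j \<partial>\<^sub>i f \<partial>\<^sub>j f\<close> contains \<open>2 Ric(\<nabla>f, \<nabla>f) - H\<^sup>2(\<nabla>f, \<nabla>f) / 2\<close>,
  because \<open>\<partial>\<^sub>t g = - 2 Ric + H\<^sup>2 / 2\<close>. By the Bochner formula (\<open>metric_chart.bochner\<close>) the Laplacian of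
  \<open>|\<nabla>f|\<^sup>2\<close> contains the same Ricci term and the same \<open>2 \<langle>\<nabla>f, \<nabla>\<Delta>f\<rangle>\<close>, so that
  \<open>\<partial>\<^sub>t \<Psi> = \<Delta> \<Psi> - 2 \<langle>\<nabla>f, \<nabla>\<Psi>\<rangle> - 2 t |\<nabla>\<^sup>2 f|\<^sup>2 - t H\<^sup>2(\<nabla>f, \<nabla>f) / 2\<close>.
  At a spatial maximum of \<open>\<Psi>\<close> the gradient term vanishes and \<open>\<Delta> \<Psi> \<le> 0\<close>, and the last two terms have
  the good sign, hence \<open>\<partial>\<^sub>t \<Psi> \<le> 0\<close> there (\<open>evolution_at_critical_point\<close>). As \<open>\<Psi> = - ln (A / u) \<le> 0\<close> at
  time \<open>0\<close>, the weak maximum principle on the compact manifold (\<open>weak_maximum_principle\<close>) gives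
  \<open>\<Psi> \<le> 0\<close>.

  Everything differential takes place in one chart with an arbitrary metric. The Bochner formula is
  derived with covariant derivatives in index notation rather than in normal coordinates: the Ricci
  identity for the Hessian (\<open>metric_chart.ricci_identity\<close>) produces the curvature, and its trace is
  recognised as the Ricci tensor by the antisymmetry \<open>metric_chart.curv_antisym\<close>, which comes from the
  symmetry of the second derivatives of \<open>g\<^sup>i\<^sup>j\<close>. Signs of contractions follow from writing the positive
  semidefinite matrix \<open>g\<^sup>i\<^sup>j\<close> as a sum of squares (\<open>psd_sum_of_squares\<close>).

  Commuting \<open>\<partial>\<^sub>t\<close> with \<open>\<partial>\<^sub>i\<close> is done for \<open>0 < t < T\<close>, where space-time is open. The maximum principle
  is therefore applied on \<open>[0, T']\<close> with \<open>T' < T\<close>, and the final time is reached by continuity.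
\<close>



section \<open>Calculus of smooth functions\<close>

text \<open>
  The Frechet derivative as a function of the base point for a fixed direction. Unlike \<open>pd\<close> it also
  covers space-time, where \<open>(axis i 1, 0)\<close> and \<open>(0, 1)\<close> are the directions \<open>\<partial>\<^sub>i\<close> and \<open>\<partial>\<^sub>t\<close>.
\<close>

definition dd :: "'a::real_normed_vector \<Rightarrow> ('a \<Rightarrow> real) \<Rightarrow> 'a \<Rightarrow> real" where
  "dd v f x = frechet_derivative f (at x) v"

lemma pd_eq_dd: "pd i f = dd (axis i 1) f"
  by (rule ext) (simp add: pd_def dd_def)

lemma dd_eqI: "(f has_derivative D) (at x) \<Longrightarrow> dd v f x = D v"
  by (simp add: dd_def frechet_derivative_at[symmetric])

lemma has_derivative_dd: "f differentiable (at x) \<Longrightarrow> (f has_derivative (\<lambda>v. dd v f x)) (at x)"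
  by (simp add: dd_def frechet_derivative_works[symmetric] eta_contract_eq)

lemma ck_on_cong:
  assumes "\<And>x. x \<in> S \<Longrightarrow> f x = g x" "ck_on k S f"
  shows "ck_on k S g"
  using assms
proof (induction k arbitrary: f g)
  case 0
  then show ?case using continuous_on_cong by force
next
  case (Suc k)
  have der: "(f has_derivative D) (at x within S) \<longleftrightarrow> (g has_derivative D) (at x within S)"
    if "x \<in> S" for x D
    using Suc.prems(1) that by (metis has_derivative_transform)
  have fd: "frechet_derivative f (at x within S) = frechet_derivative g (at x within S)"
    if "x \<in> S" for x
    by (simp add: frechet_derivative_def der[OF that])
  show ?case
    unfolding ck_on.simps
  proof (intro conjI ballI allI)
    fix x assume "x \<in> S"
    then show "g differentiable (at x within S)"
      using Suc.prems(2) der[OF \<open>x \<in> S\<close>] unfolding ck_on.simps differentiable_def by blast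
  next
    fix v
    have "ck_on k S (\<lambda>x. frechet_derivative f (at x within S) v)"
      using Suc.prems(2) by simp
    then show "ck_on k S (\<lambda>x. frechet_derivative g (at x within S) v)"
      by (rule Suc.IH[rotated]) (simp add: fd)
  qed
qed

lemma ck_on_open_subset:
  assumes "open U" "U \<subseteq> S" "ck_on k S f"
  shows "ck_on k U f"
  using assms(3)
proof (induction k arbitrary: f)
  case 0
  then show ?case using assms continuous_on_subset by auto
next
  case (Suc k)
  have at: "at x within U = at x within S" if "x \<in> U" for x
    using assms that
    by (metis at_within_interior at_within_open interior_maximal subsetD)
  show ?case
    unfolding ck_on.simps
  proof (intro conjI ballI allI)
    fix x assume "x \<in> U"
    then show "f differentiable (at x within U)"
      using Suc.prems assms(2) at by auto
  next
    fix v
    have "ck_on k U (\<lambda>x. frechet_derivative f (at x within S) v)"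
      using Suc by simp
    then show "ck_on k U (\<lambda>x. frechet_derivative f (at x within U) v)"
      by (rule ck_on_cong[rotated]) (simp add: at)
  qed
qed

lemma smooth_on_open_subset:
  "open U \<Longrightarrow> U \<subseteq> S \<Longrightarrow> smooth_on S f \<Longrightarrow> smooth_on U f"
  unfolding smooth_on_def using ck_on_open_subset by blast

lemma smooth_on_cong:
  "(\<And>x. x \<in> S \<Longrightarrow> f x = g x) \<Longrightarrow> smooth_on S f \<Longrightarrow> smooth_on S g"
  unfolding smooth_on_def using ck_on_cong by blast

text \<open>
  This is also used with \<open>I = {0..T}\<close> and \<open>t\<close> an end point: the slice \<open>V \<times> {t}\<close> stays inside
  \<open>V \<times> I\<close>, so spatial derivatives can be read off from the derivative within \<open>V \<times> I\<close> at all times.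
\<close>

lemma slice_has_derivative:
  fixes F :: "'a::real_normed_vector \<times> 'c::real_normed_vector \<Rightarrow> 'b::real_normed_vector"
  assumes "open V" "y \<in> V" "t \<in> I" "F differentiable (at (y, t) within V \<times> I)"
  shows "((\<lambda>y. F (y, t)) has_derivative (\<lambda>v. frechet_derivative F (at (y, t) within V \<times> I) (v, 0))) (at y)"
proof -
  have F: "(F has_derivative frechet_derivative F (at (y, t) within V \<times> I)) (at (y, t) within V \<times> I)"
    using assms(4) by (simp add: frechet_derivative_works)
  have sub: "(\<lambda>y. (y, t)) ` V \<subseteq> V \<times> I" using assms by auto
  have "((\<lambda>y. (y, t)) has_derivative (\<lambda>v. (v, 0))) (at y within V)"
    by (auto intro!: derivative_eq_intros)
  from diff_chain_within[OF this, of F "frechet_derivative F (at (y, t) within V \<times> I)"]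
  show ?thesis
    using has_derivative_subset[OF F sub] assms
    by (simp add: o_def at_within_open[OF _ assms(1)])
qed

lemma ck_on_slice:
  fixes F :: "'a::real_normed_vector \<times> 'c::real_normed_vector \<Rightarrow> 'b::real_normed_vector"
  assumes "open V" "t \<in> I" "ck_on k (V \<times> I) F"
  shows "ck_on k V (\<lambda>y. F (y, t))"
  using assms(3)
proof (induction k arbitrary: F)
  case 0
  have "continuous_on V (F \<circ> (\<lambda>y. (y, t)))"
    by (rule continuous_on_compose)
      (use 0 assms in \<open>auto intro!: continuous_intros elim: continuous_on_subset\<close>)
  then show ?case by (simp add: o_def)
next
  case (Suc k)
  have der: "((\<lambda>y. F (y, t)) has_derivative (\<lambda>v. frechet_derivative F (at (y, t) within V \<times> I) (v, 0))) (at y)"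
    if "y \<in> V" for y
  proof (rule slice_has_derivative[OF assms(1) that assms(2)])
    have "\<forall>z\<in>V \<times> I. F differentiable (at z within V \<times> I)"
      using Suc.prems unfolding ck_on.simps by (rule conjunct1)
    moreover have "(y, t) \<in> V \<times> I" using that assms(2) by (rule SigmaI)
    ultimately show "F differentiable (at (y, t) within V \<times> I)" by (rule bspec)
  qed
  show ?case
    unfolding ck_on.simps
  proof (intro conjI ballI allI)
    fix y assume "y \<in> V"
    then show "(\<lambda>y. F (y, t)) differentiable (at y within V)"
      using der assms(1) by (auto simp: differentiable_def at_within_open[OF _ assms(1)])
  next
    fix v
    have "ck_on k V (\<lambda>y. frechet_derivative F (at (y, t) within V \<times> I) (v, 0))"
      using Suc.prems by (intro Suc.IH) simp
    then show "ck_on k V (\<lambda>y. frechet_derivative (\<lambda>y. F (y, t)) (at y within V) v)"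
      by (rule ck_on_cong[rotated])
        (simp add: frechet_derivative_at[OF der, symmetric] at_within_open[OF _ assms(1)])
  qed
qed

lemma smooth_on_slice:
  fixes F :: "'a::real_normed_vector \<times> 'c::real_normed_vector \<Rightarrow> 'b::real_normed_vector"
  shows "open V \<Longrightarrow> t \<in> I \<Longrightarrow> smooth_on (V \<times> I) F \<Longrightarrow> smooth_on V (\<lambda>y. F (y, t))"
  unfolding smooth_on_def using ck_on_slice by blast

lemma ck_on_bounded_linear:
  assumes "bounded_linear L" "open S" "ck_on k S f"
  shows "ck_on k S (\<lambda>x. L (f x))"
  using assms(3)
proof (induction k arbitrary: f)
  case 0
  then have "continuous_on S f" by simp
  from bounded_linear.continuous_on[OF assms(1) this] show ?case by simp
next
  case (Suc k)
  have der: "((\<lambda>x. L (f x)) has_derivative (\<lambda>v. L (frechet_derivative f (at x) v))) (at x)"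
    if "x \<in> S" for x
  proof (rule bounded_linear.has_derivative[OF assms(1)])
    have "f differentiable (at x within S)" using Suc.prems that by simp
    then show "(f has_derivative (\<lambda>v. frechet_derivative f (at x) v)) (at x)"
      using at_within_open[OF that assms(2)] by (simp add: frechet_derivative_works eta_contract_eq)
  qed
  show ?case
    unfolding ck_on.simps
  proof (intro conjI ballI allI)
    fix x assume "x \<in> S"
    then show "(\<lambda>x. L (f x)) differentiable (at x within S)"
      using der assms(2) by (auto simp: differentiable_def at_within_open[OF _ assms(2)])
  next
    fix v
    have "ck_on k S (\<lambda>x. L (frechet_derivative f (at x within S) v))"
      using Suc by simp
    then show "ck_on k S (\<lambda>x. frechet_derivative (\<lambda>x. L (f x)) (at x within S) v)"
      by (rule ck_on_cong[rotated])
        (simp add: frechet_derivative_at[OF der, symmetric] at_within_open[OF _ assms(2)])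
  qed
qed

lemma smooth_on_vec_nth:
  fixes f :: "'a::real_normed_vector \<Rightarrow> ('b::real_normed_vector)^'n::finite"
  assumes "open S" "smooth_on S f"
  shows "smooth_on S (\<lambda>x. f x $ i)"
  using ck_on_bounded_linear[OF bounded_linear_vec_nth[of i] assms(1), of _ f] assms(2)
  by (simp add: smooth_on_def)

text \<open>
  On open sets the derivatives within the set are plain derivatives, which makes the recursion in
  \<open>ck_on\<close> one about \<open>dd\<close>. The closure properties below follow from it by induction on the order.
\<close>

lemma ck_on_Suc_open:
  fixes f :: "'a::real_normed_vector \<Rightarrow> real"
  assumes "open S"
  shows "ck_on (Suc k) S f \<longleftrightarrow> (\<forall>x\<in>S. f differentiable (at x)) \<and> (\<forall>v. ck_on k S (dd v f))"
proof -
  have eq: "frechet_derivative f (at x within S) v = dd v f x" if "x \<in> S" for x v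
    unfolding dd_def at_within_open[OF that assms] ..
  have "ck_on k S (\<lambda>x. frechet_derivative f (at x within S) v) \<longleftrightarrow> ck_on k S (dd v f)" for v
    using ck_on_cong[of S "\<lambda>x. frechet_derivative f (at x within S) v" "dd v f" k]
      ck_on_cong[of S "dd v f" "\<lambda>x. frechet_derivative f (at x within S) v" k] eq by metis
  moreover have "(\<forall>x\<in>S. f differentiable (at x within S)) \<longleftrightarrow> (\<forall>x\<in>S. f differentiable (at x))"
    by (intro ball_cong refl) (metis assms at_within_open)
  ultimately show ?thesis unfolding ck_on.simps by blast
qed

lemma ck_on_Suc_imp: "ck_on (Suc k) S f \<Longrightarrow> ck_on k S f"
proof (induction k arbitrary: f)
  case 0
  then show ?case
    by (auto simp: continuous_on_eq_continuous_within intro: differentiable_imp_continuous_within)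
next
  case (Suc k)
  then show ?case by (simp only: ck_on.simps) blast
qed

lemma smooth_onD:
  fixes f :: "'a::real_normed_vector \<Rightarrow> real"
  assumes "open S" "smooth_on S f"
  shows smooth_on_differentiable: "x \<in> S \<Longrightarrow> f differentiable (at x)"
    and smooth_on_dd: "smooth_on S (dd v f)"
    and smooth_on_continuous: "continuous_on S f"
proof -
  have k: "ck_on (Suc k) S f" for k using assms(2) by (simp only: smooth_on_def)
  show "x \<in> S \<Longrightarrow> f differentiable (at x)"
    using k[of 0] unfolding ck_on_Suc_open[OF assms(1)] by auto
  show "smooth_on S (dd v f)"
    using k unfolding ck_on_Suc_open[OF assms(1)] smooth_on_def by auto
  show "continuous_on S f" using assms(2) unfolding smooth_on_def by (metis ck_on.simps(1))
qed

lemma smooth_on_pd: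
  "open S \<Longrightarrow> smooth_on S f \<Longrightarrow> smooth_on S (pd i f)"
  by (simp add: pd_eq_dd smooth_on_dd)

lemma dd_const [simp]: "dd v (\<lambda>x. c) x = 0"
  by (rule dd_eqI) (auto intro!: derivative_eq_intros)

lemma dd_add:
  assumes "f differentiable (at x)" "g differentiable (at x)"
  shows "dd v (\<lambda>x. f x + g x) x = dd v f x + dd v g x"
  by (rule dd_eqI) (auto intro!: derivative_eq_intros has_derivative_dd assms)

lemma dd_diff:
  assumes "f differentiable (at x)" "g differentiable (at x)"
  shows "dd v (\<lambda>x. f x - g x) x = dd v f x - dd v g x"
  by (rule dd_eqI) (auto intro!: derivative_eq_intros has_derivative_dd assms)

lemma dd_mult:
  assumes "f differentiable (at x)" "g differentiable (at x)"
  shows "dd v (\<lambda>x. f x * g x) x = dd v f x * g x + f x * dd v g x"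
  by (rule dd_eqI) (auto intro!: derivative_eq_intros has_derivative_dd assms)

lemma dd_cmult:
  assumes "f differentiable (at x)"
  shows "dd v (\<lambda>x. c * f x) x = c * dd v f x"
  by (rule dd_eqI) (auto intro!: derivative_eq_intros has_derivative_dd assms)

lemma dd_sum:
  assumes "\<And>i. i \<in> I \<Longrightarrow> f i differentiable (at x)"
  shows "dd v (\<lambda>x. \<Sum>i\<in>I. f i x) x = (\<Sum>i\<in>I. dd v (f i) x)"
  by (rule dd_eqI) (auto intro!: derivative_eq_intros has_derivative_dd assms)

lemma dd_inverse:
  assumes "f differentiable (at x)" "f x \<noteq> 0"
  shows "dd v (\<lambda>x. inverse (f x)) x = - (dd v f x * inverse (f x) * inverse (f x))"
  by (rule dd_eqI) (use assms in \<open>auto intro!: derivative_eq_intros has_derivative_dd simp: mult_ac\<close>)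

lemma dd_ln:
  assumes "f differentiable (at x)" "f x > 0"
  shows "dd v (\<lambda>x. ln (f x)) x = dd v f x * inverse (f x)"
  by (rule dd_eqI) (use assms in \<open>auto intro!: derivative_eq_intros has_derivative_dd simp: field_simps\<close>)

lemma dd_cong_open:
  assumes "open S" "x \<in> S" "\<And>z. z \<in> S \<Longrightarrow> f z = g z"
  shows "dd v f x = dd v g x"
proof -
  have "(f has_derivative D) (at x) \<longleftrightarrow> (g has_derivative D) (at x)" for D
    using assms by (metis has_derivative_transform_within_open)
  then show ?thesis by (simp add: dd_def frechet_derivative_def)
qed


lemma ck_on_const:
  fixes c :: real
  shows "open S \<Longrightarrow> ck_on k S (\<lambda>x. c)"
proof (induction k arbitrary: c)
  case (Suc k)
  have "ck_on k S (dd v (\<lambda>x. c))" for v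
    by (rule ck_on_cong[OF _ Suc.IH[OF Suc.prems, of 0]]) simp
  then show ?case unfolding ck_on_Suc_open[OF Suc.prems] by simp
qed simp

lemma ck_on_add:
  fixes f g :: "'a::real_normed_vector \<Rightarrow> real"
  assumes "open S"
  shows "ck_on k S f \<Longrightarrow> ck_on k S g \<Longrightarrow> ck_on k S (\<lambda>x. f x + g x)"
proof (induction k arbitrary: f g)
  case (Suc k)
  have d: "\<forall>x\<in>S. f differentiable (at x)" "\<forall>x\<in>S. g differentiable (at x)"
    and v: "\<And>v. ck_on k S (dd v f)" "\<And>v. ck_on k S (dd v g)"
    using Suc.prems unfolding ck_on_Suc_open[OF assms] by auto
  have "ck_on k S (dd v (\<lambda>x. f x + g x))" for v
    by (rule ck_on_cong[OF _ Suc.IH[OF v]]) (simp add: d dd_add)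
  then show ?case unfolding ck_on_Suc_open[OF assms] using d by auto
qed (simp add: continuous_on_add)

lemma ck_on_mult:
  fixes f g :: "'a::real_normed_vector \<Rightarrow> real"
  assumes "open S"
  shows "ck_on k S f \<Longrightarrow> ck_on k S g \<Longrightarrow> ck_on k S (\<lambda>x. f x * g x)"
proof (induction k arbitrary: f g)
  case (Suc k)
  have d: "\<forall>x\<in>S. f differentiable (at x)" "\<forall>x\<in>S. g differentiable (at x)"
    and v: "\<And>v. ck_on k S (dd v f)" "\<And>v. ck_on k S (dd v g)"
    using Suc.prems unfolding ck_on_Suc_open[OF assms] by auto
  note k = Suc.prems[THEN ck_on_Suc_imp]
  have "ck_on k S (dd v (\<lambda>x. f x * g x))" for v
    by (rule ck_on_cong[OF _ ck_on_add[OF assms Suc.IH[OF v(1) k(2)] Suc.IH[OF k(1) v(2)]]])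
      (simp add: d dd_mult)
  then show ?case unfolding ck_on_Suc_open[OF assms] using d by auto
qed (simp add: continuous_on_mult)

lemma smooth_on_const: "open S \<Longrightarrow> smooth_on S (\<lambda>x. c::real)"
  by (simp add: smooth_on_def ck_on_const)

lemma smooth_on_add:
  fixes f g :: "'a::real_normed_vector \<Rightarrow> real"
  shows "open S \<Longrightarrow> smooth_on S f \<Longrightarrow> smooth_on S g \<Longrightarrow> smooth_on S (\<lambda>x. f x + g x)"
  by (simp add: smooth_on_def ck_on_add)

lemma smooth_on_mult:
  fixes f g :: "'a::real_normed_vector \<Rightarrow> real"
  shows "open S \<Longrightarrow> smooth_on S f \<Longrightarrow> smooth_on S g \<Longrightarrow> smooth_on S (\<lambda>x. f x * g x)"
  by (simp add: smooth_on_def ck_on_mult)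

lemma smooth_on_diff:
  fixes f g :: "'a::real_normed_vector \<Rightarrow> real"
  assumes "open S" "smooth_on S f" "smooth_on S g"
  shows "smooth_on S (\<lambda>x. f x - g x)"
  using smooth_on_add[OF assms(1,2) smooth_on_mult[OF assms(1) smooth_on_const[OF assms(1), of "-1"] assms(3)]]
  by simp

lemma smooth_on_sum:
  fixes f :: "'i \<Rightarrow> 'a::real_normed_vector \<Rightarrow> real"
  assumes "open S" "\<And>i. i \<in> I \<Longrightarrow> smooth_on S (f i)"
  shows "smooth_on S (\<lambda>x. \<Sum>i\<in>I. f i x)"
  using assms(2) by (induction I rule: infinite_finite_induct)
    (auto simp: smooth_on_const[OF assms(1)] smooth_on_add[OF assms(1)])

lemma smooth_on_prod:
  fixes f :: "'i \<Rightarrow> 'a::real_normed_vector \<Rightarrow> real"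
  assumes "open S" "\<And>i. i \<in> I \<Longrightarrow> smooth_on S (f i)"
  shows "smooth_on S (\<lambda>x. \<Prod>i\<in>I. f i x)"
  using assms(2) by (induction I rule: infinite_finite_induct)
    (auto simp: smooth_on_const[OF assms(1)] smooth_on_mult[OF assms(1)])

lemma smooth_on_inverse:
  fixes f :: "'a::real_normed_vector \<Rightarrow> real"
  assumes S: "open S" and f: "smooth_on S f" and nz: "\<And>x. x \<in> S \<Longrightarrow> f x \<noteq> 0"
  shows "smooth_on S (\<lambda>x. inverse (f x))"
proof -
  have d: "\<forall>x\<in>S. f differentiable (at x)" using smooth_on_differentiable[OF S f] by blast
  have "ck_on k S (\<lambda>x. inverse (f x))" for k
  proof (induction k)
    case 0
    then show ?case using smooth_on_continuous[OF S f] nz by (auto intro!: continuous_intros)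
  next
    case (Suc k)
    have "ck_on k S (dd v (\<lambda>x. inverse (f x)))" for v
    proof -
      have "ck_on k S (\<lambda>x. (-1) * (dd v f x * inverse (f x) * inverse (f x)))"
        using smooth_on_dd[OF S f, of v] Suc.IH unfolding smooth_on_def
        by (intro ck_on_mult S ck_on_const) auto
      then show ?thesis
        by (rule ck_on_cong[rotated]) (use d nz in \<open>simp add: dd_inverse\<close>)
    qed
    moreover have "(\<lambda>x. inverse (f x)) differentiable (at x)" if "x \<in> S" for x
      using d nz that by (auto intro!: derivative_intros simp: differentiable_inverse)
    ultimately show ?case unfolding ck_on_Suc_open[OF S] by blast
  qed
  then show ?thesis by (simp add: smooth_on_def)
qed

lemma smooth_on_ln:
  fixes f :: "'a::real_normed_vector \<Rightarrow> real"
  assumes S: "open S" and f: "smooth_on S f" and pos: "\<And>x. x \<in> S \<Longrightarrow> f x > 0"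
  shows "smooth_on S (\<lambda>x. ln (f x))"
proof -
  have d: "\<And>x. x \<in> S \<Longrightarrow> f differentiable (at x)" using smooth_on_differentiable[OF S f] by blast
  have nz: "f x \<noteq> 0" if "x \<in> S" for x using pos[OF that] by simp
  have "ck_on k S (\<lambda>x. ln (f x))" for k
  proof (cases k)
    case 0
    have "\<forall>x\<in>S. f x \<noteq> 0" using nz by auto
    then show ?thesis using 0 smooth_on_continuous[OF S f]
      by (auto intro!: continuous_on_ln)
  next
    case (Suc k')
    have "ck_on k' S (dd v (\<lambda>x. ln (f x)))" for v
    proof -
      have "smooth_on S (\<lambda>x. dd v f x * inverse (f x))"
        by (intro smooth_on_mult smooth_on_inverse smooth_on_dd S f nz)
      then have "ck_on k' S (\<lambda>x. dd v f x * inverse (f x))" by (simp add: smooth_on_def)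
      then show ?thesis
        by (rule ck_on_cong[rotated]) (simp add: d pos dd_ln)
    qed
    moreover have "(\<lambda>x. ln (f x)) differentiable (at x)" if "x \<in> S" for x
    proof -
      have "((\<lambda>x. ln (f x)) has_derivative (\<lambda>v. dd v f x * inverse (f x))) (at x)"
        using has_derivative_dd[OF d[OF that]] pos[OF that]
        by (auto intro!: derivative_eq_intros simp: field_simps)
      then show ?thesis by (auto simp: differentiable_def)
    qed
    ultimately show ?thesis unfolding Suc ck_on_Suc_open[OF S] by blast
  qed
  then show ?thesis by (simp add: smooth_on_def)
qed

lemmas smooth_intros =
  smooth_on_const smooth_on_add smooth_on_mult smooth_on_diff smooth_on_sum smooth_on_dd smooth_on_pd

lemma line_has_derivative:
  assumes "f differentiable (at (z + s *\<^sub>R v))"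
  shows "((\<lambda>s. f (z + s *\<^sub>R v)) has_real_derivative dd v f (z + s *\<^sub>R v)) (at s)"
proof -
  have 1: "((\<lambda>s. z + s *\<^sub>R v) has_derivative (\<lambda>h. h *\<^sub>R v)) (at s)"
    by (auto intro!: derivative_eq_intros)
  note 2 = has_derivative_dd[OF assms]
  have lin: "linear (\<lambda>w. dd w f (z + s *\<^sub>R v))"
    using 2 has_derivative_linear by blast
  have "((\<lambda>s. f (z + s *\<^sub>R v)) has_derivative (\<lambda>h. dd (h *\<^sub>R v) f (z + s *\<^sub>R v))) (at s)"
    using has_derivative_compose[OF 1 2] by simp
  also have "(\<lambda>h. dd (h *\<^sub>R v) f (z + s *\<^sub>R v)) = (\<lambda>h. dd v f (z + s *\<^sub>R v) * h)"
    using linear_cmul[OF lin] by (auto simp: mult.commute)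
  finally show ?thesis by (simp add: has_field_derivative_def)
qed

text \<open>
  The mean value theorem, once in direction \<open>v\<close> and once in direction \<open>w\<close>. The left-hand side is
  symmetric in \<open>v\<close> and \<open>w\<close>, which is why mixed derivatives commute.
\<close>

lemma second_difference_mean_value:
  fixes f :: "'a::real_normed_vector \<Rightarrow> real"
  assumes S: "open S" and f: "smooth_on S f" and h: "h > 0"
    and sub: "\<And>a b. 0 \<le> a \<Longrightarrow> a \<le> h \<Longrightarrow> 0 \<le> b \<Longrightarrow> b \<le> h \<Longrightarrow> z + a *\<^sub>R v + b *\<^sub>R w \<in> S"
  shows "\<exists>a b. 0 < a \<and> a < h \<and> 0 < b \<and> b < h \<and>
    f (z + h *\<^sub>R v + h *\<^sub>R w) - f (z + h *\<^sub>R v) - f (z + h *\<^sub>R w) + f z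
      = h * h * dd w (dd v f) (z + a *\<^sub>R v + b *\<^sub>R w)"
proof -
  let ?\<phi> = "\<lambda>s. f ((z + h *\<^sub>R w) + s *\<^sub>R v) - f (z + s *\<^sub>R v)"
  have dphi: "(?\<phi> has_real_derivative
      dd v f ((z + h *\<^sub>R w) + s *\<^sub>R v) - dd v f (z + s *\<^sub>R v)) (at s)" if "0 \<le> s" "s \<le> h" for s
  proof (intro DERIV_diff line_has_derivative smooth_on_differentiable[OF S f])
    show "z + h *\<^sub>R w + s *\<^sub>R v \<in> S" using sub[of s h] that h by (simp add: algebra_simps)
    show "z + s *\<^sub>R v \<in> S" using sub[of s 0] that h by simp
  qed
  from MVT2[OF h, of ?\<phi>, OF dphi] obtain a where a: "0 < a" "a < h"
    and eq1: "?\<phi> h - ?\<phi> 0 = h * (dd v f ((z + h *\<^sub>R w) + a *\<^sub>R v) - dd v f (z + a *\<^sub>R v))" by auto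
  let ?\<psi> = "\<lambda>s. dd v f ((z + a *\<^sub>R v) + s *\<^sub>R w)"
  have dpsi: "(?\<psi> has_real_derivative dd w (dd v f) ((z + a *\<^sub>R v) + s *\<^sub>R w)) (at s)"
    if "0 \<le> s" "s \<le> h" for s
    using sub[of a s] that a
    by (intro line_has_derivative smooth_on_differentiable[OF S smooth_on_dd[OF S f]]) auto
  from MVT2[OF h, of ?\<psi>, OF dpsi] obtain b where b: "0 < b" "b < h"
    and eq2: "?\<psi> h - ?\<psi> 0 = h * dd w (dd v f) ((z + a *\<^sub>R v) + b *\<^sub>R w)" by auto
  show ?thesis
    using a b eq1 eq2 by (intro exI[of _ a] exI[of _ b]) (simp add: algebra_simps)
qed

lemma dd_commute:
  fixes f :: "'a::real_normed_vector \<Rightarrow> real"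
  assumes S: "open S" and f: "smooth_on S f" and z: "z \<in> S"
  shows "dd v (dd w f) z = dd w (dd v f) z"
proof -
  have c: "isCont (dd w (dd v f)) z" "isCont (dd v (dd w f)) z"
    using smooth_on_continuous[OF S smooth_on_dd[OF S smooth_on_dd[OF S f]]] S z
    by (auto simp: continuous_on_eq_continuous_at)
  obtain r where r: "r > 0" "ball z r \<subseteq> S" using S z openE by blast
  have "\<bar>dd v (dd w f) z - dd w (dd v f) z\<bar> \<le> 0 + e" if e: "e > 0" for e
  proof -
    from c(1) e obtain d1 where d1: "d1 > 0"
      "\<And>x. dist x z < d1 \<Longrightarrow> \<bar>dd w (dd v f) x - dd w (dd v f) z\<bar> < e/2"
      unfolding continuous_at_eps_delta dist_real_def by (meson half_gt_zero)
    from c(2) e obtain d2 where d2: "d2 > 0"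
      "\<And>x. dist x z < d2 \<Longrightarrow> \<bar>dd v (dd w f) x - dd v (dd w f) z\<bar> < e/2"
      unfolding continuous_at_eps_delta dist_real_def by (meson half_gt_zero)
    define d where "d = min r (min d1 d2)"
    have d: "d > 0" "d \<le> r" "d \<le> d1" "d \<le> d2" using r d1 d2 by (auto simp: d_def)
    \<comment> \<open>The parallelogram spanned by \<open>h v\<close> and \<open>h w\<close> at \<open>z\<close> then lies in the ball of radius \<open>d\<close>;
      the summand 1 avoids dividing by zero for \<open>v = w = 0\<close>.\<close>
    define h where "h = d / (2 * (norm v + norm w + 1))"
    have den: "norm v + norm w + 1 > 0" by (smt (verit) norm_ge_zero)
    have h: "h > 0" unfolding h_def using d(1) den by simp
    have hd: "h * (norm v + norm w) < d"
    proof -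
      have "h * (norm v + norm w) \<le> h * (norm v + norm w + 1)" using h by simp
      also have "\<dots> = d / 2" unfolding h_def using den by (simp add: field_simps)
      also have "\<dots> < d" using d by simp
      finally show ?thesis .
    qed
    have near: "dist (z + a *\<^sub>R v + b *\<^sub>R w) z < d" if "0 \<le> a" "a \<le> h" "0 \<le> b" "b \<le> h" for a b
    proof -
      have "dist (z + a *\<^sub>R v + b *\<^sub>R w) z = norm (a *\<^sub>R v + b *\<^sub>R w)"
        by (simp add: dist_norm algebra_simps)
      also have "\<dots> \<le> a * norm v + b * norm w"
        using norm_triangle_ineq[of "a *\<^sub>R v" "b *\<^sub>R w"] that by simp
      also have "\<dots> \<le> h * norm v + h * norm w"
        using that by (intro add_mono mult_right_mono) auto
      finally show ?thesis using hd by (simp add: algebra_simps)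
    qed
    have sub: "z + a *\<^sub>R v + b *\<^sub>R w \<in> S" if "0 \<le> a" "a \<le> h" "0 \<le> b" "b \<le> h" for a b
      using near[OF that] r(2) d(2) by (auto simp: dist_commute)
    have sub': "z + a *\<^sub>R w + b *\<^sub>R v \<in> S" if "0 \<le> a" "a \<le> h" "0 \<le> b" "b \<le> h" for a b
      using sub[of b a] that by (simp add: algebra_simps)
    obtain a b where ab: "0 < a" "a < h" "0 < b" "b < h"
      and e1: "f (z + h *\<^sub>R v + h *\<^sub>R w) - f (z + h *\<^sub>R v) - f (z + h *\<^sub>R w) + f z
        = h * h * dd w (dd v f) (z + a *\<^sub>R v + b *\<^sub>R w)"
      using second_difference_mean_value[OF S f h, of z v w] sub by auto
    obtain a' b' where ab': "0 < a'" "a' < h" "0 < b'" "b' < h"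
      and e2: "f (z + h *\<^sub>R w + h *\<^sub>R v) - f (z + h *\<^sub>R w) - f (z + h *\<^sub>R v) + f z
        = h * h * dd v (dd w f) (z + a' *\<^sub>R w + b' *\<^sub>R v)"
      using second_difference_mean_value[OF S f h, of z w v] sub' by auto
    have "h * h * dd w (dd v f) (z + a *\<^sub>R v + b *\<^sub>R w) = h * h * dd v (dd w f) (z + b' *\<^sub>R v + a' *\<^sub>R w)"
      using e1 e2 by (simp add: algebra_simps)
    then have "dd w (dd v f) (z + a *\<^sub>R v + b *\<^sub>R w) = dd v (dd w f) (z + b' *\<^sub>R v + a' *\<^sub>R w)"
      using h by simp
    moreover have "\<bar>dd w (dd v f) (z + a *\<^sub>R v + b *\<^sub>R w) - dd w (dd v f) z\<bar> < e/2"
      using near[of a b] ab d by (intro d1) auto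
    moreover have "\<bar>dd v (dd w f) (z + b' *\<^sub>R v + a' *\<^sub>R w) - dd v (dd w f) z\<bar> < e/2"
      using near[of b' a'] ab' d by (intro d2) auto
    ultimately show ?thesis by linarith
  qed
  then have "\<bar>dd v (dd w f) z - dd w (dd v f) z\<bar> \<le> 0"
    by (rule field_le_epsilon)
  then show ?thesis by linarith
qed


section \<open>Positive semidefinite contractions\<close>

lemma sum_swap_pairs:
  fixes f :: "'i \<Rightarrow> 'j \<Rightarrow> 'k \<Rightarrow> 'l \<Rightarrow> 'b::comm_monoid_add"
  shows "(\<Sum>i\<in>I. \<Sum>j\<in>J. \<Sum>k\<in>K. \<Sum>l\<in>L. f i j k l) = (\<Sum>k\<in>K. \<Sum>l\<in>L. \<Sum>i\<in>I. \<Sum>j\<in>J. f i j k l)"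
proof -
  have "(\<Sum>i\<in>I. \<Sum>j\<in>J. \<Sum>k\<in>K. \<Sum>l\<in>L. f i j k l) = (\<Sum>i\<in>I. \<Sum>k\<in>K. \<Sum>j\<in>J. \<Sum>l\<in>L. f i j k l)"
    by (intro sum.cong refl sum.swap)
  also have "\<dots> = (\<Sum>k\<in>K. \<Sum>i\<in>I. \<Sum>l\<in>L. \<Sum>j\<in>J. f i j k l)"
    by (subst sum.swap) (intro sum.cong refl sum.swap)
  also have "\<dots> = (\<Sum>k\<in>K. \<Sum>l\<in>L. \<Sum>i\<in>I. \<Sum>j\<in>J. f i j k l)"
    by (intro sum.cong refl sum.swap)
  finally show ?thesis .
qed

definition quad :: "('n::finite \<Rightarrow> 'n \<Rightarrow> real) \<Rightarrow> ('n \<Rightarrow> real) \<Rightarrow> real" where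
  "quad A v = (\<Sum>i\<in>UNIV. \<Sum>j\<in>UNIV. A i j * v i * v j)"

text \<open>
  Moving along one coordinate axis: the computation behind completing the square below.
\<close>

lemma quad_add_axis:
  assumes sym: "\<And>i j. A i j = A j i"
  shows "quad A (\<lambda>i. v i + (if i = s then c else 0))
    = quad A v + 2 * c * (\<Sum>j\<in>UNIV. A s j * v j) + c * c * A s s"
proof -
  have "quad A (\<lambda>i. v i + (if i = s then c else 0)) =
     (\<Sum>i\<in>UNIV. \<Sum>j\<in>UNIV. A i j * v i * v j + A i j * v i * (if j = s then c else 0)
        + (A i j * (if i = s then c else 0) * v j + A i j * (if i = s then c else 0) * (if j = s then c else 0)))"
    unfolding quad_def by (intro sum.cong refl) (simp add: algebra_simps)
  also have "\<dots> = quad A v + (\<Sum>i\<in>UNIV. A i s * v i * c)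
      + ((\<Sum>i\<in>UNIV. \<Sum>j\<in>UNIV. A i j * (if i = s then c else 0) * v j)
      + (\<Sum>i\<in>UNIV. A i s * (if i = s then c else 0) * c))"
    by (simp add: quad_def sum.distrib if_distrib[of "\<lambda>x. _ * x"] sum.delta cong: if_cong)
  also have "(\<Sum>i\<in>UNIV. \<Sum>j\<in>UNIV. A i j * (if i = s then c else 0) * v j)
      = (\<Sum>j\<in>UNIV. \<Sum>i\<in>UNIV. A i j * (if i = s then c else 0) * v j)"
    by (rule sum.swap)
  also have "\<dots> = (\<Sum>j\<in>UNIV. A s j * c * v j)"
    by (intro sum.cong refl)
      (simp add: if_distrib[of "\<lambda>x. _ * x"] if_distrib[of "\<lambda>x. x * _"] sum.delta cong: if_cong)
  also have "(\<Sum>i\<in>UNIV. A i s * v i * c) = (\<Sum>j\<in>UNIV. A s j * c * v j)"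
    by (intro sum.cong refl) (simp add: sym[of _ s])
  also have "(\<Sum>i\<in>UNIV. A i s * (if i = s then c else 0) * c) = c * c * A s s"
    by (simp add: if_distrib[of "\<lambda>x. _ * x"] if_distrib[of "\<lambda>x. x * _"] sum.delta cong: if_cong)
  finally show ?thesis by (simp add: sum_distrib_left algebra_simps)
qed

text \<open>
  A Cholesky decomposition, by induction on the set \<open>S\<close> of rows that may be nonzero. If the
  pivot \<open>A s s\<close> vanishes then so does the whole row, by semidefiniteness. Otherwise subtracting
  the rank-one matrix \<open>A s i * A s j / A s s\<close> clears row \<open>s\<close>, and the Schur complement that remains
  is again positive semidefinite.
\<close>

lemma psd_sum_of_squares_on:
  fixes A :: "'n::finite \<Rightarrow> 'n \<Rightarrow> real"
  assumes "finite S" "\<And>i j. A i j = A j i" "\<And>v. quad A v \<ge> 0"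
    "\<And>i j. i \<notin> S \<Longrightarrow> A i j = 0"
  shows "\<exists>w. \<forall>i j. A i j = (\<Sum>k\<in>S. w k i * w k j)"
  using assms
proof (induction S arbitrary: A rule: finite_induct)
  case (insert s S)
  note sym = insert.prems(1) and psd = insert.prems(2) and supp = insert.prems(3)
  have ax: "quad A (\<lambda>i. if i = k then c else 0) = c * c * A k k" for k c
    using quad_add_axis[of A "\<lambda>_. 0" k c] sym by (simp add: quad_def)
  show ?case
  proof (cases "A s s = 0")
    case True
    have row: "A s j = 0" for j
    proof (rule ccontr)
      assume nz: "A s j \<noteq> 0"
      let ?v = "\<lambda>i. if i = j then 1 else (0::real)"
      have "(\<Sum>i\<in>UNIV. A s i * ?v i) = A s j"
        by (simp add: if_distrib[of "\<lambda>x. _ * x"] sum.delta cong: if_cong)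
      then have q: "0 \<le> A j j + 2 * c * A s j" for c
        using psd[of "\<lambda>i. ?v i + (if i = s then c else 0)"] quad_add_axis[of A ?v s c] sym True
          ax[of j 1] by simp
      \<comment> \<open>This value of \<open>c\<close> makes the affine function of \<open>c\<close> equal to \<open>-1\<close>.\<close>
      show False using q[of "- (A j j + 1) / (2 * A s j)"] nz by (simp add: field_simps)
    qed
    have "A i j = 0" if "i \<notin> S" for i j
      using supp[of i j] row that by (cases "i = s") auto
    then obtain w where w: "\<forall>i j. A i j = (\<Sum>k\<in>S. w k i * w k j)"
      using insert.IH[of A] sym psd by blast
    have "A i j = (\<Sum>k\<in>insert s S. (w(s := \<lambda>_. 0)) k i * (w(s := \<lambda>_. 0)) k j)" for i j
      using insert.hyps w by (auto intro!: sum.cong)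
    then show ?thesis by blast
  next
    case False
    let ?a = "A s s"
    have a: "?a > 0" using psd[of "\<lambda>i. if i = s then 1 else 0"] ax[of s 1] False by simp
    define B where "B = (\<lambda>i j. A i j - A s i * A s j / ?a)"
    have symB: "B i j = B j i" for i j unfolding B_def using sym[of i j] by simp
    have psdB: "quad B v \<ge> 0" for v
    proof -
      let ?\<sigma> = "\<Sum>j\<in>UNIV. A s j * v j"
      have "quad B v = quad A v - (\<Sum>i\<in>UNIV. \<Sum>j\<in>UNIV. (A s i * v i) * (A s j * v j)) / ?a"
        unfolding quad_def B_def
        by (simp add: algebra_simps sum_subtractf sum_divide_distrib)
      also have "(\<Sum>i\<in>UNIV. \<Sum>j\<in>UNIV. (A s i * v i) * (A s j * v j)) = ?\<sigma> * ?\<sigma>"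
        by (simp add: sum_product)
      \<comment> \<open>Completing the square: the minimum of the quadratic form along the axis \<open>s\<close>.\<close>
      also have "quad A v - ?\<sigma> * ?\<sigma> / ?a = quad A (\<lambda>i. v i + (if i = s then - ?\<sigma> / ?a else 0))"
        using quad_add_axis[of A v s "- ?\<sigma> / ?a"] sym a by (simp add: field_simps)
      finally show ?thesis using psd by simp
    qed
    have suppB: "B i j = 0" if "i \<notin> S" for i j
    proof (cases "i = s")
      case True then show ?thesis using a by (simp add: B_def)
    next
      case F: False
      then have "A i j = 0" "A s i = 0" using supp[of i] sym[of s i] that by auto
      then show ?thesis by (simp add: B_def)
    qed
    obtain w where w: "\<forall>i j. B i j = (\<Sum>k\<in>S. w k i * w k j)"
      using insert.IH[of B] symB psdB suppB by blast
    let ?w = "w(s := \<lambda>i. A s i / sqrt ?a)"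
    have "A i j = (\<Sum>k\<in>insert s S. ?w k i * ?w k j)" for i j
    proof -
      have "(\<Sum>k\<in>S. ?w k i * ?w k j) = B i j"
        using w insert.hyps by (auto intro!: sum.cong)
      moreover have "?w s i * ?w s j = A s i * A s j / ?a" using a by simp
      ultimately show ?thesis using insert.hyps by (simp add: B_def)
    qed
    then show ?thesis by blast
  qed
qed simp

lemma psd_sum_of_squares:
  fixes A :: "'n::finite \<Rightarrow> 'n \<Rightarrow> real"
  assumes "\<And>i j. A i j = A j i" "\<And>v. quad A v \<ge> 0"
  obtains w :: "'n \<Rightarrow> 'n \<Rightarrow> real" where "\<And>i j. A i j = (\<Sum>k\<in>UNIV. w k i * w k j)"
proof -
  have "\<exists>w :: 'n \<Rightarrow> 'n \<Rightarrow> real. \<forall>i j. A i j = (\<Sum>k\<in>UNIV. w k i * w k j)"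
    by (rule psd_sum_of_squares_on) (use assms in simp_all)
  then show ?thesis using that by metis
qed

lemma psd_contraction_nonneg:
  fixes A B :: "'n::finite \<Rightarrow> 'n \<Rightarrow> real"
  assumes A: "\<And>i j. A i j = A j i" "\<And>v. quad A v \<ge> 0" and B: "\<And>v. quad B v \<ge> 0"
  shows "0 \<le> (\<Sum>i\<in>UNIV. \<Sum>j\<in>UNIV. A i j * B i j)"
proof -
  obtain w :: "'n \<Rightarrow> 'n \<Rightarrow> real" where w: "\<And>i j. A i j = (\<Sum>k\<in>UNIV. w k i * w k j)"
    using psd_sum_of_squares[OF A] by blast
  have "(\<Sum>i\<in>UNIV. \<Sum>j\<in>UNIV. A i j * B i j) = (\<Sum>i\<in>UNIV. \<Sum>j\<in>UNIV. \<Sum>k\<in>UNIV. B i j * w k i * w k j)"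
    by (intro sum.cong refl) (simp add: w sum_distrib_left sum_distrib_right mult_ac)
  also have "\<dots> = (\<Sum>i\<in>UNIV. \<Sum>k\<in>UNIV. \<Sum>j\<in>UNIV. B i j * w k i * w k j)"
    by (intro sum.cong refl sum.swap)
  also have "\<dots> = (\<Sum>k\<in>UNIV. quad B (w k))"
    unfolding quad_def by (rule sum.swap)
  also have "\<dots> \<ge> 0" using B by (intro sum_nonneg)
  finally show ?thesis .
qed

text \<open>
  The squared norm of a two-tensor is nonnegative. It is applied to the Hessian and to \<open>i\<^sub>v H\<close>.
\<close>

lemma psd_double_contraction_nonneg:
  fixes A C :: "'n::finite \<Rightarrow> 'n \<Rightarrow> real"
  assumes A: "\<And>i j. A i j = A j i" "\<And>v. quad A v \<ge> 0"
  shows "0 \<le> (\<Sum>k\<in>UNIV. \<Sum>l\<in>UNIV. \<Sum>p\<in>UNIV. \<Sum>q\<in>UNIV. A k l * A p q * C k p * C l q)"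
proof -
  let ?B = "\<lambda>k l. \<Sum>p\<in>UNIV. \<Sum>q\<in>UNIV. A p q * C k p * C l q"
  have "quad ?B v = quad A (\<lambda>p. \<Sum>k\<in>UNIV. C k p * v k)" for v
  proof -
    have "quad ?B v = (\<Sum>k\<in>UNIV. \<Sum>l\<in>UNIV. \<Sum>p\<in>UNIV. \<Sum>q\<in>UNIV. A p q * (C k p * v k) * (C l q * v l))"
      unfolding quad_def
      by (intro sum.cong refl) (simp add: sum_distrib_left sum_distrib_right mult_ac)
    also have "\<dots> = (\<Sum>p\<in>UNIV. \<Sum>q\<in>UNIV. \<Sum>k\<in>UNIV. \<Sum>l\<in>UNIV. A p q * (C k p * v k) * (C l q * v l))"
      by (rule sum_swap_pairs)
    also have "\<dots> = quad A (\<lambda>p. \<Sum>k\<in>UNIV. C k p * v k)"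
      unfolding quad_def
      by (intro sum.cong refl) (simp add: sum_distrib_left sum_distrib_right mult_ac)
    finally show ?thesis .
  qed
  then have "0 \<le> (\<Sum>k\<in>UNIV. \<Sum>l\<in>UNIV. A k l * ?B k l)"
    using A by (intro psd_contraction_nonneg) auto
  then show ?thesis by (simp add: sum_distrib_left mult_ac)
qed

section \<open>Inverse of a metric\<close>

text \<open>
  The pointwise condition in \<open>riemannian_metric\<close>, separated from charts and smoothness.
\<close>

definition metric_matrix :: "real^'n^'n \<Rightarrow> bool" where
  "metric_matrix M \<longleftrightarrow> (\<forall>i j. M $ i $ j = M $ j $ i) \<and> (\<forall>v. v \<noteq> 0 \<longrightarrow> v \<bullet> (M *v v) > 0)"

lemma metric_matrix_invertible:
  fixes M :: "real^'n^'n"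
  assumes "metric_matrix M"
  shows "invertible M"
proof -
  have "x = 0" if "M *v x = 0" for x
    using assms that unfolding metric_matrix_def by (metis inner_zero_right less_irrefl)
  then show ?thesis
    unfolding invertible_left_inverse matrix_left_invertible_ker by blast
qed

lemma matrix_inv_inverse:
  fixes M :: "real^'n^'n"
  assumes "invertible M"
  shows "M ** matrix_inv M = mat 1" "matrix_inv M ** M = mat 1"
  using someI_ex[OF assms[unfolded invertible_def]] unfolding matrix_inv_def by auto

lemma matrix_mult_entry:
  fixes A B :: "real^'n^'n"
  shows "A ** B = mat 1 \<longleftrightarrow> (\<forall>i k. (\<Sum>j\<in>UNIV. A $ i $ j * B $ j $ k) = (if i = k then 1 else 0))"
  by (simp add: matrix_matrix_mult_def mat_def vec_eq_iff)

lemma metric_inverse_sym: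
  fixes M :: "real^'n^'n"
  assumes "metric_matrix M"
  shows "matrix_inv M $ i $ j = matrix_inv M $ j $ i"
proof -
  note inv = matrix_inv_inverse[OF metric_matrix_invertible[OF assms]]
  have "transpose M = M" using assms by (simp add: metric_matrix_def transpose_def vec_eq_iff)
  then have left: "transpose (matrix_inv M) ** M = mat 1"
    using inv(1) by (metis matrix_transpose_mul transpose_mat)
  have "transpose (matrix_inv M) = (transpose (matrix_inv M) ** M) ** matrix_inv M"
    by (simp only: matrix_mul_assoc[symmetric] inv matrix_mul_rid)
  also have "\<dots> = matrix_inv M"
    by (simp add: left)
  finally have eq: "transpose (matrix_inv M) = matrix_inv M" .
  have "matrix_inv M $ i $ j = transpose (matrix_inv M) $ j $ i"
    by (simp add: transpose_def)
  then show ?thesis by (simp add: eq)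
qed

lemma inner_matrix_quad: "v \<bullet> (M *v v) = quad (\<lambda>i j. M $ i $ j) (\<lambda>i. v $ i)"
  by (simp add: inner_vec_def matrix_vector_mult_def quad_def sum_distrib_left mult_ac)

lemma metric_inverse_psd:
  fixes M :: "real^'n^'n"
  assumes "metric_matrix M"
  shows "quad (\<lambda>i j. matrix_inv M $ i $ j) v \<ge> 0"
proof -
  note inv = matrix_inv_inverse[OF metric_matrix_invertible[OF assms]]
  let ?v = "\<chi> i. v i" and ?N = "matrix_inv M"
  have "quad (\<lambda>i j. ?N $ i $ j) v = ?v \<bullet> (?N *v ?v)"
    by (simp add: inner_matrix_quad)
  also have "\<dots> = (M *v (?N *v ?v)) \<bullet> (?N *v ?v)"
    by (simp add: matrix_vector_mul_assoc inv)
  also have "\<dots> \<ge> 0"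
    using assms unfolding metric_matrix_def
    by (cases "?N *v ?v = 0") (auto simp: inner_commute less_imp_le)
  finally show ?thesis .
qed

text \<open>
  Cramer's rule expresses the entries of the inverse as rational functions of the entries of the
  matrix, so that they inherit smoothness and continuity.
\<close>

lemma matrix_inv_cramer:
  fixes M :: "real^'n^'n"
  assumes "invertible M"
  shows "matrix_inv M $ k $ l = det (\<chi> i j. if j = k then (if i = l then 1 else 0) else M $ i $ j) / det M"
proof -
  have "M *v (matrix_inv M *v axis l 1) = axis l 1"
    by (simp add: matrix_vector_mul_assoc matrix_inv_inverse[OF assms])
  then have "matrix_inv M *v axis l 1
      = (\<chi> k. det (\<chi> i j. if j = k then axis l 1 $ i else M $ i $ j) / det M)"
    using cramer[of M] assms by (simp add: invertible_det_nz)
  then have "(matrix_inv M *v axis l 1) $ k = det (\<chi> i j. if j = k then axis l 1 $ i else M $ i $ j) / det M"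
    by simp
  moreover have "(matrix_inv M *v axis l 1) $ k = matrix_inv M $ k $ l"
    by (simp add: matrix_vector_mult_basis column_def)
  moreover have "axis l (1::real) $ i = (if i = l then 1 else 0)" for i by (auto simp: axis_def)
  ultimately show ?thesis by (simp cong: if_cong)
qed

lemma smooth_on_det:
  fixes M :: "'a::real_normed_vector \<Rightarrow> real^'n^'n"
  assumes "open S" "\<And>i j. smooth_on S (\<lambda>x. M x $ i $ j)"
  shows "smooth_on S (\<lambda>x. det (M x))"
  unfolding det_def by (intro smooth_intros smooth_on_prod assms)

lemma smooth_on_matrix_inv:
  fixes M :: "'a::real_normed_vector \<Rightarrow> real^'n^'n"
  assumes S: "open S" and M: "\<And>i j. smooth_on S (\<lambda>x. M x $ i $ j)"
    and inv: "\<And>x. x \<in> S \<Longrightarrow> invertible (M x)"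
  shows "smooth_on S (\<lambda>x. matrix_inv (M x) $ k $ l)"
proof -
  let ?C = "\<lambda>x. (\<chi> i j. if j = k then (if i = l then 1 else 0) else M x $ i $ j) :: real^'n^'n"
  have C: "smooth_on S (\<lambda>x. ?C x $ i $ j)" for i j
    using M[of i j] smooth_on_const[OF S] by (cases "j = k") simp_all
  have "smooth_on S (\<lambda>x. det (?C x) * inverse (det (M x)))"
    by (intro smooth_on_mult smooth_on_inverse smooth_on_det S C M)
      (use inv invertible_det_nz in auto)
  then show ?thesis
    by (rule smooth_on_cong[rotated]) (simp add: matrix_inv_cramer inv divide_inverse)
qed

lemma continuous_on_matrix_inv:
  fixes M :: "'a::topological_space \<Rightarrow> real^'n^'n"
  assumes M: "continuous_on S M" and inv: "\<And>x. x \<in> S \<Longrightarrow> invertible (M x)"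
  shows "continuous_on S (\<lambda>x. matrix_inv (M x) $ k $ l)"
proof -
  let ?C = "\<lambda>x. (\<chi> i j. if j = k then (if i = l then 1 else 0) else M x $ i $ j) :: real^'n^'n"
  have e: "continuous_on S (\<lambda>x. M x $ i $ j)" for i j
    by (intro continuous_intros M)
  have C: "continuous_on S (\<lambda>x. ?C x $ i $ j)" for i j
    using e[of i j] by (cases "j = k") simp_all
  have "continuous_on S (\<lambda>x. det (?C x) / det (M x))"
    using inv invertible_det_nz unfolding det_def
    by (intro continuous_intros C e) (auto simp flip: det_def)
  then show ?thesis
    by (rule continuous_on_cong[THEN iffD1, rotated 2]) (simp_all add: matrix_inv_cramer inv)
qed

text \<open>
  The formula \<open>\<partial>(M\<inverse>) = - M\<inverse> (\<partial>M) M\<inverse>\<close>, from differentiating \<open>M M\<inverse> = 1\<close>.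
\<close>

lemma dd_matrix_inv:
  fixes M :: "'a::real_normed_vector \<Rightarrow> real^'n^'n"
  assumes S: "open S" and M: "\<And>i j. smooth_on S (\<lambda>x. M x $ i $ j)"
    and inv: "\<And>x. x \<in> S \<Longrightarrow> invertible (M x)" and x: "x \<in> S"
  shows "dd v (\<lambda>x. matrix_inv (M x) $ i $ j) x =
    - (\<Sum>a\<in>UNIV. \<Sum>b\<in>UNIV. matrix_inv (M x) $ i $ a * dd v (\<lambda>x. M x $ a $ b) x * matrix_inv (M x) $ b $ j)"
proof -
  let ?N = "\<lambda>i j x. matrix_inv (M x) $ i $ j"
  have dM: "(\<lambda>x. M x $ a $ b) differentiable (at x)" for a b
    by (rule smooth_on_differentiable[OF S M x])
  have dN: "(\<lambda>x. matrix_inv (M x) $ a $ b) differentiable (at x)" for a b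
    by (rule smooth_on_differentiable[OF S smooth_on_matrix_inv[OF S M inv] x])
  have MN: "(\<Sum>b\<in>UNIV. M z $ a $ b * ?N b j z) = (if a = j then 1 else 0)" if "z \<in> S" for z a
    using matrix_inv_inverse(1)[OF inv[OF that]] by (simp add: matrix_mult_entry)
  have NM: "(\<Sum>a\<in>UNIV. ?N i a x * M x $ a $ b) = (if i = b then 1 else 0)" for b
    using matrix_inv_inverse(2)[OF inv[OF x]] by (simp add: matrix_mult_entry)
  have "dd v (\<lambda>z. \<Sum>b\<in>UNIV. M z $ a $ b * ?N b j z) x = dd v (\<lambda>z. if a = j then 1 else 0) x" for a
    by (rule dd_cong_open[OF S x]) (rule MN)
  then have row: "(\<Sum>b\<in>UNIV. dd v (\<lambda>z. M z $ a $ b) x * ?N b j x) + (\<Sum>b\<in>UNIV. M x $ a $ b * dd v (?N b j) x) = 0"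
    for a
    by (simp add: dd_sum dd_mult dM dN differentiable_mult sum.distrib)
  have "0 = (\<Sum>a\<in>UNIV. ?N i a x * ((\<Sum>b\<in>UNIV. dd v (\<lambda>z. M z $ a $ b) x * ?N b j x)
      + (\<Sum>b\<in>UNIV. M x $ a $ b * dd v (?N b j) x)))"
    by (simp only: row) simp
  also have "\<dots> = (\<Sum>a\<in>UNIV. \<Sum>b\<in>UNIV. ?N i a x * dd v (\<lambda>z. M z $ a $ b) x * ?N b j x)
      + (\<Sum>a\<in>UNIV. \<Sum>b\<in>UNIV. ?N i a x * M x $ a $ b * dd v (?N b j) x)"
    by (simp add: distrib_left sum.distrib sum_distrib_left mult_ac)
  also have "(\<Sum>a\<in>UNIV. \<Sum>b\<in>UNIV. ?N i a x * M x $ a $ b * dd v (?N b j) x)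
      = (\<Sum>b\<in>UNIV. (\<Sum>a\<in>UNIV. ?N i a x * M x $ a $ b) * dd v (?N b j) x)"
    by (subst sum.swap) (simp add: sum_distrib_right)
  also have "\<dots> = dd v (?N i j) x"
    by (simp add: NM if_distrib[of "\<lambda>x. x * _"] cong: if_cong)
  finally show ?thesis by linarith
qed


section \<open>Covariant calculus in a chart\<close>

text \<open>
  The squared length \<open>|df|\<^sup>2\<close>, computed from the inverse metric.
\<close>

definition grad_sq :: "(real^'n \<Rightarrow> real^'n^'n) \<Rightarrow> (real^'n \<Rightarrow> real) \<Rightarrow> real^'n \<Rightarrow> real" where
  "grad_sq G f y = (\<Sum>i\<in>UNIV. \<Sum>j\<in>UNIV. ginv G y i j * pd i f y * pd j f y)"

text \<open>
  A Riemannian metric in a single chart, with no reference to a manifold.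
\<close>

locale metric_chart =
  fixes V :: "(real^'n::finite) set" and G :: "real^'n \<Rightarrow> real^'n^'n"
  assumes open_V: "open V"
    and smooth_G: "\<And>i j. smooth_on V (\<lambda>y. G y $ i $ j)"
    and metric_G: "\<And>y. y \<in> V \<Longrightarrow> metric_matrix (G y)"
begin

abbreviation h :: "'n \<Rightarrow> 'n \<Rightarrow> real^'n \<Rightarrow> real" where "h i j \<equiv> \<lambda>y. ginv G y i j"
abbreviation \<Gamma> :: "'n \<Rightarrow> 'n \<Rightarrow> 'n \<Rightarrow> real^'n \<Rightarrow> real" where "\<Gamma> \<equiv> christoffel G"

lemma smooth_h: "smooth_on V (h i j)"
  unfolding ginv_def
  by (intro smooth_on_matrix_inv open_V smooth_G metric_matrix_invertible metric_G)

lemma smooth_christoffel: "smooth_on V (\<Gamma> k i j)"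
proof -
  have "smooth_on V (\<lambda>y. (1/2) * (\<Sum>l\<in>UNIV. h k l y *
     (pd i (\<lambda>z. G z $ j $ l) y + pd j (\<lambda>z. G z $ i $ l) y - pd l (\<lambda>z. G z $ i $ j) y)))"
    by (intro smooth_intros open_V smooth_h smooth_G)
  then show ?thesis by (simp add: christoffel_def[abs_def])
qed

lemma h_sym: "y \<in> V \<Longrightarrow> h i j y = h j i y"
  unfolding ginv_def by (intro metric_inverse_sym metric_G)

lemma G_sym: "y \<in> V \<Longrightarrow> G y $ i $ j = G y $ j $ i"
  using metric_G unfolding metric_matrix_def by blast

lemma pd_cong:
  "y \<in> V \<Longrightarrow> (\<And>z. z \<in> V \<Longrightarrow> f z = g z) \<Longrightarrow> pd i f y = pd i g y"
  unfolding pd_eq_dd by (rule dd_cong_open[OF open_V])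

lemma pd_G_sym: "y \<in> V \<Longrightarrow> pd k (\<lambda>y. G y $ i $ j) y = pd k (\<lambda>y. G y $ j $ i) y"
  by (rule pd_cong) (simp_all add: G_sym)

lemma christoffel_sym: "y \<in> V \<Longrightarrow> \<Gamma> k i j y = \<Gamma> k j i y"
  unfolding christoffel_def
  by (intro arg_cong2[of _ _ _ _ "(*)"] refl sum.cong) (simp add: pd_G_sym[of y _ i j])

lemma pd_christoffel_sym: "y \<in> V \<Longrightarrow> pd l (\<Gamma> k i j) y = pd l (\<Gamma> k j i) y"
  by (rule pd_cong) (simp_all add: christoffel_sym)

lemma differentiable_V: "y \<in> V \<Longrightarrow> smooth_on V f \<Longrightarrow> f differentiable (at y)" for f :: "real^'n \<Rightarrow> real"
  by (rule smooth_on_differentiable[OF open_V])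

lemma pd_mult:
  "y \<in> V \<Longrightarrow> smooth_on V f \<Longrightarrow> smooth_on V g \<Longrightarrow>
    pd i (\<lambda>y. f y * g y) y = pd i f y * g y + f y * pd i g y"
  unfolding pd_eq_dd by (intro dd_mult differentiable_V)

lemma pd_cmult:
  "y \<in> V \<Longrightarrow> smooth_on V f \<Longrightarrow> pd i (\<lambda>y. c * f y) y = c * pd i f y"
  unfolding pd_eq_dd by (intro dd_cmult differentiable_V)

lemma pd_diff:
  "y \<in> V \<Longrightarrow> smooth_on V f \<Longrightarrow> smooth_on V g \<Longrightarrow>
    pd i (\<lambda>y. f y - g y) y = pd i f y - pd i g y"
  unfolding pd_eq_dd by (intro dd_diff differentiable_V)

lemma pd_sum:
  "y \<in> V \<Longrightarrow> (\<And>j. smooth_on V (f j)) \<Longrightarrow>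
    pd i (\<lambda>y. \<Sum>j\<in>UNIV. f j y) y = (\<Sum>j\<in>UNIV. pd i (f j) y)"
  unfolding pd_eq_dd by (intro dd_sum differentiable_V)

lemma pd_sum_mult:
  "y \<in> V \<Longrightarrow> (\<And>j. smooth_on V (f j)) \<Longrightarrow> (\<And>j. smooth_on V (g j)) \<Longrightarrow>
    pd i (\<lambda>y. \<Sum>j\<in>UNIV. f j y * g j y) y = (\<Sum>j\<in>UNIV. pd i (f j) y * g j y + f j y * pd i (g j) y)"
  by (subst pd_sum) (auto intro!: sum.cong pd_mult smooth_on_mult open_V)

lemma pd_commute: "y \<in> V \<Longrightarrow> smooth_on V f \<Longrightarrow> pd i (pd j f) y = pd j (pd i f) y"
  unfolding pd_eq_dd by (rule dd_commute[OF open_V])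

text \<open>
  The inverse metric is parallel: \<open>\<nabla>\<^sub>k g\<^sup>i\<^sup>j = 0\<close>.
\<close>

lemma pd_h:
  assumes y: "y \<in> V"
  shows "pd k (h i j) y = - (\<Sum>l\<in>UNIV. \<Gamma> i k l y * h l j y) - (\<Sum>l\<in>UNIV. \<Gamma> j k l y * h l i y)"
proof -
  let ?d = "\<lambda>k a b. pd k (\<lambda>y. G y $ a $ b) y"
  have "pd k (h i j) y = - (\<Sum>a\<in>UNIV. \<Sum>l\<in>UNIV. h i a y * ?d k a l * h l j y)"
    unfolding pd_eq_dd ginv_def
    by (rule dd_matrix_inv[OF open_V smooth_G metric_matrix_invertible[OF metric_G] y])
  also have "(\<Sum>a\<in>UNIV. \<Sum>l\<in>UNIV. h i a y * ?d k a l * h l j y)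
      = (\<Sum>l\<in>UNIV. \<Sum>a\<in>UNIV. h i a y * ?d k a l * h l j y)"
    by (rule sum.swap)
  also have "\<dots> = (\<Sum>l\<in>UNIV. \<Sum>a\<in>UNIV. (1/2) * (h i a y * (?d k l a + ?d l k a - ?d a k l)) * h l j y
      + (1/2) * (h j l y * (?d k a l + ?d a k l - ?d l k a)) * h a i y)"
    by (intro sum.cong refl)
      (simp add: pd_G_sym[OF y, of k] h_sym[OF y, of j] h_sym[OF y, of _ i] algebra_simps)
  also have "\<dots> = (\<Sum>l\<in>UNIV. \<Sum>a\<in>UNIV. (1/2) * (h i a y * (?d k l a + ?d l k a - ?d a k l)) * h l j y)
      + (\<Sum>l\<in>UNIV. \<Sum>a\<in>UNIV. (1/2) * (h j l y * (?d k a l + ?d a k l - ?d l k a)) * h a i y)"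
    by (simp add: sum.distrib)
  also have "(\<Sum>l\<in>UNIV. \<Sum>a\<in>UNIV. (1/2) * (h j l y * (?d k a l + ?d a k l - ?d l k a)) * h a i y)
      = (\<Sum>a\<in>UNIV. \<Sum>l\<in>UNIV. (1/2) * (h j l y * (?d k a l + ?d a k l - ?d l k a)) * h a i y)"
    by (rule sum.swap)
  finally show ?thesis
    unfolding christoffel_def by (simp only: sum_distrib_left sum_distrib_right minus_add_distrib diff_conv_add_uminus)
qed

text \<open>
  Covariant derivatives \<open>\<nabla>\<^sub>l\<close> of a vector field, a one-form and a covariant two-tensor, the fields
  being given by their component functions.
\<close>

definition cov_vec :: "'n \<Rightarrow> ('n \<Rightarrow> real^'n \<Rightarrow> real) \<Rightarrow> 'n \<Rightarrow> real^'n \<Rightarrow> real" where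
  "cov_vec l F j y = pd l (F j) y + (\<Sum>m\<in>UNIV. \<Gamma> j l m y * F m y)"

definition cov_form :: "'n \<Rightarrow> ('n \<Rightarrow> real^'n \<Rightarrow> real) \<Rightarrow> 'n \<Rightarrow> real^'n \<Rightarrow> real" where
  "cov_form l a j y = pd l (a j) y - (\<Sum>m\<in>UNIV. \<Gamma> m l j y * a m y)"

definition cov_form2 :: "'n \<Rightarrow> ('n \<Rightarrow> 'n \<Rightarrow> real^'n \<Rightarrow> real) \<Rightarrow> 'n \<Rightarrow> 'n \<Rightarrow> real^'n \<Rightarrow> real" where
  "cov_form2 l W k j y = pd l (W k j) y - (\<Sum>m\<in>UNIV. \<Gamma> m l k y * W m j y) - (\<Sum>m\<in>UNIV. \<Gamma> m l j y * W k m y)"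

text \<open>
  The Christoffel terms of the vector and of the form cancel in the contraction. The next three
  lemmas express in the same way that \<open>\<nabla>\<close> obeys the product rule and commutes with contraction and
  with raising indices; together they replace normal coordinates.
\<close>

lemma pd_contract:
  assumes y: "y \<in> V" and F: "\<And>j. smooth_on V (F j)" and a: "\<And>j. smooth_on V (a j)"
  shows "pd l (\<lambda>y. \<Sum>j\<in>UNIV. F j y * a j y) y
    = (\<Sum>j\<in>UNIV. cov_vec l F j y * a j y + F j y * cov_form l a j y)"
proof -
  have "(\<Sum>j\<in>UNIV. F j y * (\<Sum>m\<in>UNIV. \<Gamma> m l j y * a m y)) = (\<Sum>j\<in>UNIV. \<Sum>m\<in>UNIV. \<Gamma> m l j y * F j y * a m y)"
    by (simp add: sum_distrib_left mult_ac)
  also have "\<dots> = (\<Sum>m\<in>UNIV. (\<Sum>j\<in>UNIV. \<Gamma> m l j y * F j y) * a m y)"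
    by (subst sum.swap) (simp add: sum_distrib_right)
  finally show ?thesis
    unfolding pd_sum_mult[OF y F a] cov_vec_def cov_form_def
    by (simp add: algebra_simps sum.distrib sum_subtractf)
qed

lemma cov_form_contract:
  assumes y: "y \<in> V" and F: "\<And>j. smooth_on V (F j)" and W: "\<And>k j. smooth_on V (W k j)"
  shows "cov_form l (\<lambda>k y. \<Sum>j\<in>UNIV. F j y * W k j y) k y
    = (\<Sum>j\<in>UNIV. cov_vec l F j y * W k j y + F j y * cov_form2 l W k j y)"
proof -
  have 1: "pd l (\<lambda>y. \<Sum>j\<in>UNIV. F j y * W k j y) y
      = (\<Sum>j\<in>UNIV. cov_vec l F j y * W k j y + F j y * cov_form l (W k) j y)"
    by (rule pd_contract[OF y F W])
  have "(\<Sum>m\<in>UNIV. \<Gamma> m l k y * (\<Sum>j\<in>UNIV. F j y * W m j y)) = (\<Sum>m\<in>UNIV. \<Sum>j\<in>UNIV. F j y * (\<Gamma> m l k y * W m j y))"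
    by (simp add: sum_distrib_left mult_ac)
  also have "\<dots> = (\<Sum>j\<in>UNIV. F j y * (\<Sum>m\<in>UNIV. \<Gamma> m l k y * W m j y))"
    by (subst sum.swap) (simp add: sum_distrib_left)
  finally have 2: "cov_form l (\<lambda>k y. \<Sum>j\<in>UNIV. F j y * W k j y) k y
     = (\<Sum>j\<in>UNIV. cov_vec l F j y * W k j y + F j y * cov_form l (W k) j y)
       - (\<Sum>j\<in>UNIV. F j y * (\<Sum>m\<in>UNIV. \<Gamma> m l k y * W m j y))"
    unfolding cov_form_def[of l "\<lambda>k y. \<Sum>j\<in>UNIV. F j y * W k j y"] 1 by simp
  show ?thesis
    unfolding 2 sum_subtractf[symmetric]
    by (intro sum.cong refl) (simp add: cov_form_def cov_form2_def algebra_simps)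
qed

lemma cov_vec_raise:
  assumes y: "y \<in> V" and a: "\<And>j. smooth_on V (a j)"
  shows "cov_vec l (\<lambda>j y. \<Sum>i\<in>UNIV. h j i y * a i y) j y = (\<Sum>i\<in>UNIV. h j i y * cov_form l a i y)"
proof -
  have 1: "pd l (\<lambda>y. \<Sum>i\<in>UNIV. h j i y * a i y) y = (\<Sum>i\<in>UNIV. pd l (h j i) y * a i y + h j i y * pd l (a i) y)"
    by (rule pd_sum_mult[OF y smooth_h a])
  have 2: "(\<Sum>m\<in>UNIV. \<Gamma> j l m y * (\<Sum>i\<in>UNIV. h m i y * a i y)) = (\<Sum>i\<in>UNIV. (\<Sum>m\<in>UNIV. \<Gamma> j l m y * h m i y) * a i y)"
    unfolding sum_distrib_left sum_distrib_right by (subst sum.swap) (simp add: mult_ac)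
  have 3: "(\<Sum>i\<in>UNIV. h j i y * (\<Sum>m\<in>UNIV. \<Gamma> m l i y * a m y)) = (\<Sum>i\<in>UNIV. (\<Sum>m\<in>UNIV. \<Gamma> i l m y * h m j y) * a i y)"
    unfolding sum_distrib_left sum_distrib_right
    by (subst sum.swap) (simp add: h_sym[OF y, of j] mult_ac)
  have "cov_vec l (\<lambda>j y. \<Sum>i\<in>UNIV. h j i y * a i y) j y = (\<Sum>i\<in>UNIV. h j i y * pd l (a i) y)
      - (\<Sum>i\<in>UNIV. (\<Sum>m\<in>UNIV. \<Gamma> i l m y * h m j y) * a i y)"
    unfolding cov_vec_def 1 2 pd_h[OF y]
    by (simp add: algebra_simps sum.distrib sum_subtractf)
  also have "\<dots> = (\<Sum>i\<in>UNIV. h j i y * cov_form l a i y)"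
    unfolding 3[symmetric] cov_form_def by (simp add: algebra_simps sum_subtractf)
  finally show ?thesis .
qed

lemma pd_trace:
  assumes y: "y \<in> V" and W: "\<And>k j. smooth_on V (W k j)"
  shows "pd l (\<lambda>y. \<Sum>k\<in>UNIV. \<Sum>j\<in>UNIV. h k j y * W k j y) y
    = (\<Sum>k\<in>UNIV. \<Sum>j\<in>UNIV. h k j y * cov_form2 l W k j y)"
proof -
  have "pd l (\<lambda>y. \<Sum>k\<in>UNIV. \<Sum>j\<in>UNIV. h k j y * W k j y) y
      = (\<Sum>k\<in>UNIV. pd l (\<lambda>y. \<Sum>j\<in>UNIV. h k j y * W k j y) y)"
    by (intro pd_sum y smooth_intros open_V smooth_h W)
  also have "\<dots> = (\<Sum>k\<in>UNIV. \<Sum>j\<in>UNIV. pd l (h k j) y * W k j y + h k j y * pd l (W k j) y)"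
    by (intro sum.cong refl pd_sum_mult y smooth_h W)
  also have "\<dots> = (\<Sum>k\<in>UNIV. \<Sum>j\<in>UNIV. h k j y * pd l (W k j) y)
      - (\<Sum>k\<in>UNIV. \<Sum>j\<in>UNIV. \<Sum>m\<in>UNIV. \<Gamma> k l m y * h m j y * W k j y)
      - (\<Sum>k\<in>UNIV. \<Sum>j\<in>UNIV. \<Sum>m\<in>UNIV. \<Gamma> j l m y * h m k y * W k j y)"
    unfolding pd_h[OF y]
    by (simp add: algebra_simps sum.distrib sum_subtractf sum_distrib_left sum_distrib_right)
  also have "(\<Sum>k\<in>UNIV. \<Sum>j\<in>UNIV. \<Sum>m\<in>UNIV. \<Gamma> k l m y * h m j y * W k j y)
      = (\<Sum>k\<in>UNIV. \<Sum>j\<in>UNIV. \<Sum>m\<in>UNIV. h k j y * (\<Gamma> m l k y * W m j y))"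
  proof -
    have "(\<Sum>k\<in>UNIV. \<Sum>j\<in>UNIV. \<Sum>m\<in>UNIV. \<Gamma> k l m y * h m j y * W k j y)
      = (\<Sum>k\<in>UNIV. \<Sum>m\<in>UNIV. \<Sum>j\<in>UNIV. \<Gamma> k l m y * h m j y * W k j y)"
      by (intro sum.cong refl sum.swap)
    also have "\<dots> = (\<Sum>m\<in>UNIV. \<Sum>k\<in>UNIV. \<Sum>j\<in>UNIV. \<Gamma> k l m y * h m j y * W k j y)"
      by (rule sum.swap)
    also have "\<dots> = (\<Sum>m\<in>UNIV. \<Sum>j\<in>UNIV. \<Sum>k\<in>UNIV. \<Gamma> k l m y * h m j y * W k j y)"
      by (intro sum.cong refl sum.swap)
    finally show ?thesis by (simp add: mult_ac)
  qed
  also have "(\<Sum>k\<in>UNIV. \<Sum>j\<in>UNIV. \<Sum>m\<in>UNIV. \<Gamma> j l m y * h m k y * W k j y)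
      = (\<Sum>k\<in>UNIV. \<Sum>j\<in>UNIV. \<Sum>m\<in>UNIV. h k j y * (\<Gamma> m l j y * W k m y))"
  proof -
    have "(\<Sum>k\<in>UNIV. \<Sum>j\<in>UNIV. \<Sum>m\<in>UNIV. \<Gamma> j l m y * h m k y * W k j y)
      = (\<Sum>k\<in>UNIV. \<Sum>m\<in>UNIV. \<Sum>j\<in>UNIV. \<Gamma> j l m y * h m k y * W k j y)"
      by (intro sum.cong refl sum.swap)
    then show ?thesis by (simp add: mult_ac h_sym[OF y])
  qed
  finally show ?thesis
    unfolding cov_form2_def
    by (simp add: algebra_simps sum.distrib sum_subtractf sum_distrib_left)
qed

section \<open>Curvature\<close>

text \<open>
  The component \<open>p\<close> of \<open>R(\<partial>\<^sub>j, \<partial>\<^sub>l) \<partial>\<^sub>k\<close>. With this convention the trace over \<open>p\<close> and \<open>j\<close> is the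
  Ricci tensor.
\<close>

definition curv :: "'n \<Rightarrow> 'n \<Rightarrow> 'n \<Rightarrow> 'n \<Rightarrow> real^'n \<Rightarrow> real" where
  "curv p k j l y = pd j (\<Gamma> p l k) y - pd l (\<Gamma> p j k) y
     + (\<Sum>m\<in>UNIV. \<Gamma> p j m y * \<Gamma> m l k y - \<Gamma> p l m y * \<Gamma> m j k y)"

lemma ricci_eq_curv:
  assumes y: "y \<in> V"
  shows "ricci G y $ i $ j = (\<Sum>k\<in>UNIV. curv k i k j y)"
  unfolding ricci_def curv_def
  by (simp add: sum.distrib christoffel_sym[OF y, of _ i] pd_christoffel_sym[OF y, of _ _ i])

lemma curv_swap: "curv p k j l y = - curv p k l j y"
  by (simp add: curv_def sum_negf[symmetric] sum_subtractf)

text \<open>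
  Since \<open>g\<^sup>k\<^sup>p\<close> is parallel, differentiating it twice expresses the commutator
  \<open>\<partial>\<^sub>j \<partial>\<^sub>l g\<^sup>k\<^sup>p - \<partial>\<^sub>l \<partial>\<^sub>j g\<^sup>k\<^sup>p = 0\<close> through the curvature: it is minus the sum of the two
  contractions that are compared below.
\<close>

lemma curv_antisym:
  assumes y: "y \<in> V"
  shows "(\<Sum>m\<in>UNIV. curv k m j l y * h m p y) = - (\<Sum>m\<in>UNIV. curv p m j l y * h m k y)"
proof -
  define A where "A k p j l = (\<Sum>m\<in>UNIV. (pd j (\<Gamma> k l m) y - (\<Sum>s\<in>UNIV. \<Gamma> k l s y * \<Gamma> s j m y)) * h m p y)"
    for k p j l
  \<comment> \<open>The mixed products of two Christoffel symbols; exchanging \<open>j\<close> with \<open>l\<close> and \<open>k\<close> with \<open>p\<close> leaves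
    them unchanged, so they drop out of the commutator.\<close>
  define X where "X k p j l = (\<Sum>m\<in>UNIV. \<Sum>s\<in>UNIV. \<Gamma> k l m y * \<Gamma> p j s y * h s m y)" for k p j l
  have half: "(\<Sum>m\<in>UNIV. pd j (\<Gamma> k l m) y * h m p y + \<Gamma> k l m y * pd j (h m p) y) = A k p j l - X k p j l"
    for k p j l
  proof -
    have "(\<Sum>m\<in>UNIV. pd j (\<Gamma> k l m) y * h m p y + \<Gamma> k l m y * pd j (h m p) y)
       = (\<Sum>m\<in>UNIV. pd j (\<Gamma> k l m) y * h m p y)
         - (\<Sum>m\<in>UNIV. \<Sum>s\<in>UNIV. \<Gamma> k l m y * \<Gamma> m j s y * h s p y) - X k p j l"
      unfolding pd_h[OF y] X_def
      by (simp add: algebra_simps sum.distrib sum_subtractf sum_distrib_left)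
    also have "(\<Sum>m\<in>UNIV. \<Sum>s\<in>UNIV. \<Gamma> k l m y * \<Gamma> m j s y * h s p y)
      = (\<Sum>m\<in>UNIV. \<Sum>s\<in>UNIV. \<Gamma> k l s y * \<Gamma> s j m y * h m p y)"
      by (rule sum.swap)
    finally show ?thesis
      unfolding A_def by (simp add: algebra_simps sum_subtractf sum_distrib_left sum_distrib_right)
  qed
  have dd: "pd j (pd l (h k p)) y = - (A k p j l - X k p j l) - (A p k j l - X p k j l)" for k p j l
  proof -
    have "pd j (pd l (h k p)) y
      = pd j (\<lambda>y. - 1 * (\<Sum>m\<in>UNIV. \<Gamma> k l m y * h m p y) - (\<Sum>m\<in>UNIV. \<Gamma> p l m y * h m k y)) y"
      by (rule pd_cong[OF y]) (simp add: pd_h)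
    also have "\<dots> = - 1 * pd j (\<lambda>y. \<Sum>m\<in>UNIV. \<Gamma> k l m y * h m p y) y
        - pd j (\<lambda>y. \<Sum>m\<in>UNIV. \<Gamma> p l m y * h m k y) y"
      by (subst pd_diff pd_cmult, (intro y smooth_intros open_V smooth_christoffel smooth_h)+)+ simp
    finally show ?thesis
      unfolding pd_sum_mult[OF y smooth_christoffel smooth_h] half by simp
  qed
  have X: "X k p j l = X p k l j" for k p j l
    unfolding X_def by (subst sum.swap) (simp add: h_sym[OF y] mult_ac)
  have R: "A k p j l - A k p l j = (\<Sum>m\<in>UNIV. curv k m j l y * h m p y)" for k p j l
    unfolding A_def curv_def sum_subtractf[symmetric]
    by (intro sum.cong refl) (simp add: algebra_simps sum_subtractf)
  have "pd j (pd l (h k p)) y = pd l (pd j (h k p)) y"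
    by (rule pd_commute[OF y smooth_h])
  then have "(A k p j l - A k p l j) + (A p k j l - A p k l j) = 0"
    unfolding dd using X[of k p j l] X[of p k j l] by linarith
  then show ?thesis unfolding R by linarith
qed

section \<open>The Bochner formula\<close>

lemma smooth_hessian: "smooth_on V f \<Longrightarrow> smooth_on V (\<lambda>y. hessian G f y $ i $ j)"
  unfolding hessian_def by (simp, intro smooth_intros open_V smooth_christoffel)

lemma hessian_cov: "hessian G f y $ i $ j = cov_form i (\<lambda>j. pd j f) j y"
  by (simp add: hessian_def cov_form_def)

lemma hessian_sym:
  "y \<in> V \<Longrightarrow> smooth_on V f \<Longrightarrow> hessian G f y $ i $ j = hessian G f y $ j $ i"
  by (simp add: hessian_def pd_commute[of y f i j] christoffel_sym[of y _ i j])

text \<open>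
  The third derivatives of \<open>f\<close> are symmetric, so only the Christoffel symbols fail to commute; what
  they leave behind is the curvature applied to \<open>df\<close>.
\<close>

lemma ricci_identity:
  assumes y: "y \<in> V" and f: "smooth_on V f"
  defines "W \<equiv> \<lambda>i j y. hessian G f y $ i $ j"
  shows "cov_form2 l W k j y = cov_form2 j W l k y + (\<Sum>p\<in>UNIV. pd p f y * curv p k j l y)"
proof -
  have dW: "pd l (W k j) y = pd l (pd k (pd j f)) y
      - (\<Sum>m\<in>UNIV. pd l (\<Gamma> m k j) y * pd m f y + \<Gamma> m k j y * pd l (pd m f) y)" for l k j
  proof -
    have "pd l (W k j) y = pd l (\<lambda>y. pd k (pd j f) y - (\<Sum>m\<in>UNIV. \<Gamma> m k j y * pd m f y)) y"
      unfolding W_def hessian_def by simp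
    also have "\<dots> = pd l (pd k (pd j f)) y - pd l (\<lambda>y. \<Sum>m\<in>UNIV. \<Gamma> m k j y * pd m f y) y"
      by (intro pd_diff y smooth_intros open_V smooth_christoffel f)
    also have "pd l (\<lambda>y. \<Sum>m\<in>UNIV. \<Gamma> m k j y * pd m f y) y
       = (\<Sum>m\<in>UNIV. pd l (\<Gamma> m k j) y * pd m f y + \<Gamma> m k j y * pd l (pd m f) y)"
      by (intro pd_sum_mult y smooth_intros open_V smooth_christoffel f)
    finally show ?thesis .
  qed
  have third: "pd l (pd k (pd j f)) y = pd j (pd l (pd k f)) y"
  proof -
    have "pd l (pd k (pd j f)) y = pd l (pd j (pd k f)) y"
      by (rule pd_cong[OF y]) (rule pd_commute[OF _ f])
    also have "\<dots> = pd j (pd l (pd k f)) y"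
      by (intro pd_commute y smooth_intros open_V f)
    finally show ?thesis .
  qed
  have W: "W m j y = pd m (pd j f) y - (\<Sum>p\<in>UNIV. \<Gamma> p m j y * pd p f y)" for m j
    by (simp add: W_def hessian_def)
  have swap: "(\<Sum>m\<in>UNIV. \<Gamma> m a b y * (\<Sum>p\<in>UNIV. \<Gamma> p c m y * pd p f y))
      = (\<Sum>p\<in>UNIV. pd p f y * (\<Sum>m\<in>UNIV. \<Gamma> p c m y * \<Gamma> m a b y))" for a b c
    unfolding sum_distrib_left by (subst sum.swap) (simp add: mult_ac)
  have GW: "(\<Sum>m\<in>UNIV. \<Gamma> m a b y * W c m y) = (\<Sum>m\<in>UNIV. \<Gamma> m a b y * pd c (pd m f) y)
      - (\<Sum>p\<in>UNIV. pd p f y * (\<Sum>m\<in>UNIV. \<Gamma> p c m y * \<Gamma> m a b y))" for a b c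
    unfolding W swap[symmetric] by (simp add: algebra_simps sum_subtractf)
  have Wsym: "W a b y = W b a y" for a b
    unfolding W_def by (rule hessian_sym[OF y f])
  have GW': "(\<Sum>m\<in>UNIV. \<Gamma> m a b y * W m c y) = (\<Sum>m\<in>UNIV. \<Gamma> m a b y * W c m y)" for a b c
    by (simp add: Wsym[of _ c])
  have "cov_form2 l W k j y - cov_form2 j W l k y
     = pd l (W k j) y - pd j (W l k) y - (\<Sum>m\<in>UNIV. \<Gamma> m l k y * W j m y) + (\<Sum>m\<in>UNIV. \<Gamma> m j k y * W l m y)"
    unfolding cov_form2_def GW' by (simp add: christoffel_sym[OF y, of _ j l])
  also have "\<dots> = (\<Sum>p\<in>UNIV. pd p f y * pd j (\<Gamma> p l k) y) - (\<Sum>p\<in>UNIV. pd p f y * pd l (\<Gamma> p j k) y)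
      + (\<Sum>p\<in>UNIV. pd p f y * (\<Sum>m\<in>UNIV. \<Gamma> p j m y * \<Gamma> m l k y))
      - (\<Sum>p\<in>UNIV. pd p f y * (\<Sum>m\<in>UNIV. \<Gamma> p l m y * \<Gamma> m j k y))"
    unfolding dW GW third
    by (simp add: sum.distrib christoffel_sym[OF y, of _ k j] pd_christoffel_sym[OF y, of _ _ k j] mult_ac)
  also have "\<dots> = (\<Sum>p\<in>UNIV. pd p f y * curv p k j l y)"
    unfolding curv_def by (simp add: algebra_simps sum.distrib sum_subtractf)
  finally show ?thesis by simp
qed

lemma gradient_raise: "gradient G f y $ j = (\<Sum>i\<in>UNIV. h j i y * pd i f y)"
  by (simp add: gradient_def)

lemma grad_sq_gradient:
  "grad_sq G f y = (\<Sum>i\<in>UNIV. gradient G f y $ i * pd i f y)"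
  by (simp add: grad_sq_def gradient_def sum_distrib_left sum_distrib_right mult_ac)

lemma smooth_grad_sq: "smooth_on V f \<Longrightarrow> smooth_on V (grad_sq G f)"
  unfolding grad_sq_def[abs_def] by (intro smooth_intros open_V smooth_h)

lemma smooth_laplacian: "smooth_on V f \<Longrightarrow> smooth_on V (laplacian G f)"
  unfolding laplacian_def[abs_def] by (intro smooth_intros open_V smooth_h smooth_hessian)

lemma smooth_gradient: "smooth_on V f \<Longrightarrow> smooth_on V (\<lambda>y. gradient G f y $ i)"
  unfolding gradient_raise by (intro smooth_intros open_V smooth_h)

lemma cov_gradient:
  assumes y: "y \<in> V" and f: "smooth_on V f"
  shows "cov_vec l (\<lambda>j y. gradient G f y $ j) j y = (\<Sum>i\<in>UNIV. h j i y * hessian G f y $ l $ i)"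
  unfolding gradient_raise hessian_cov
  by (rule cov_vec_raise[OF y smooth_on_pd[OF open_V f]])

lemma contract_gradient:
  assumes y: "y \<in> V"
  shows "(\<Sum>j\<in>UNIV. (\<Sum>i\<in>UNIV. h j i y * a i) * pd j f y) = (\<Sum>i\<in>UNIV. gradient G f y $ i * a i)"
  unfolding gradient_raise sum_distrib_right
  by (subst sum.swap) (simp add: h_sym[OF y] mult_ac)

lemma pd_grad_sq:
  assumes y: "y \<in> V" and f: "smooth_on V f"
  shows "pd k (grad_sq G f) y = 2 * (\<Sum>j\<in>UNIV. gradient G f y $ j * hessian G f y $ k $ j)"
proof -
  have "pd k (grad_sq G f) y = pd k (\<lambda>y. \<Sum>j\<in>UNIV. gradient G f y $ j * pd j f y) y"
    by (simp add: grad_sq_gradient[abs_def])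
  also have "\<dots> = (\<Sum>j\<in>UNIV. cov_vec k (\<lambda>j y. gradient G f y $ j) j y * pd j f y
      + gradient G f y $ j * cov_form k (\<lambda>j. pd j f) j y)"
    by (rule pd_contract[OF y smooth_gradient[OF f] smooth_on_pd[OF open_V f]])
  also have "\<dots> = 2 * (\<Sum>j\<in>UNIV. gradient G f y $ j * hessian G f y $ k $ j)"
    unfolding sum.distrib cov_gradient[OF y f] contract_gradient[OF y] hessian_cov by simp
  finally show ?thesis .
qed

lemma hessian_grad_sq:
  assumes y: "y \<in> V" and f: "smooth_on V f"
  shows "hessian G (grad_sq G f) y $ l $ k =
    2 * (\<Sum>j\<in>UNIV. (\<Sum>i\<in>UNIV. h j i y * hessian G f y $ l $ i) * hessian G f y $ k $ j
       + gradient G f y $ j * cov_form2 l (\<lambda>i j y. hessian G f y $ i $ j) k j y)"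
proof -
  let ?F = "\<lambda>j y. gradient G f y $ j" and ?W = "\<lambda>k j y. hessian G f y $ k $ j"
  have "pd l (pd k (grad_sq G f)) y = pd l (\<lambda>y. 2 * (\<Sum>j\<in>UNIV. ?F j y * ?W k j y)) y"
    by (rule pd_cong[OF y]) (rule pd_grad_sq[OF _ f])
  also have "\<dots> = 2 * pd l (\<lambda>y. (\<Sum>j\<in>UNIV. ?F j y * ?W k j y)) y"
    by (intro pd_cmult y smooth_intros open_V smooth_gradient smooth_hessian f)
  finally have "hessian G (grad_sq G f) y $ l $ k = 2 * cov_form l (\<lambda>k y. \<Sum>j\<in>UNIV. ?F j y * ?W k j y) k y"
    unfolding hessian_cov[of "grad_sq G f"] cov_form_def
    by (simp add: pd_grad_sq[OF y f] sum_distrib_left algebra_simps)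
  then show ?thesis
    unfolding cov_form_contract[OF y smooth_gradient[OF f] smooth_hessian[OF f]] cov_gradient[OF y f] .
qed

text \<open>
  This is where the antisymmetry of the curvature enters: it moves the index contracted with \<open>df\<close>
  into the position in which the remaining trace is the Ricci tensor.
\<close>

lemma curvature_contraction:
  assumes y: "y \<in> V"
  shows "(\<Sum>l\<in>UNIV. \<Sum>k\<in>UNIV. h l k y * (\<Sum>p\<in>UNIV. pd p f y * curv p k j l y))
    = (\<Sum>k\<in>UNIV. gradient G f y $ k * ricci G y $ k $ j)"
proof -
  have key: "(\<Sum>k\<in>UNIV. curv p k j l y * h k l y) = (\<Sum>k\<in>UNIV. curv l k l j y * h k p y)" for l p
    unfolding curv_antisym[OF y, of p j l l] curv_swap[of l _ j l] by (simp add: sum_negf)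
  have "(\<Sum>l\<in>UNIV. \<Sum>k\<in>UNIV. h l k y * (\<Sum>p\<in>UNIV. pd p f y * curv p k j l y))
      = (\<Sum>l\<in>UNIV. \<Sum>p\<in>UNIV. pd p f y * (\<Sum>k\<in>UNIV. curv p k j l y * h k l y))"
    unfolding sum_distrib_left
    by (rule sum.cong[OF refl], subst sum.swap) (simp add: h_sym[OF y] mult_ac)
  also have "\<dots> = (\<Sum>l\<in>UNIV. \<Sum>p\<in>UNIV. pd p f y * (\<Sum>k\<in>UNIV. curv l k l j y * h k p y))"
    by (simp only: key)
  also have "\<dots> = (\<Sum>l\<in>UNIV. \<Sum>k\<in>UNIV. \<Sum>p\<in>UNIV. pd p f y * (curv l k l j y * h k p y))"
    unfolding sum_distrib_left by (rule sum.cong[OF refl]) (rule sum.swap)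
  also have "\<dots> = (\<Sum>l\<in>UNIV. \<Sum>k\<in>UNIV. gradient G f y $ k * curv l k l j y)"
    by (simp add: gradient_raise sum_distrib_left sum_distrib_right mult_ac)
  also have "\<dots> = (\<Sum>k\<in>UNIV. \<Sum>l\<in>UNIV. gradient G f y $ k * curv l k l j y)"
    by (rule sum.swap)
  finally show ?thesis
    by (simp add: ricci_eq_curv[OF y] sum_distrib_left)
qed

text \<open>
  The trace of \<open>hessian_grad_sq\<close>. The Ricci identity moves the derivative index of \<open>\<nabla>\<^sup>2 f\<close> outside the
  trace, which turns the third-order term into \<open>\<langle>\<nabla>f, \<nabla>\<Delta>f\<rangle>\<close> at the cost of \<open>Ric(\<nabla>f, \<nabla>f)\<close>.
\<close>

theorem bochner:
  assumes y: "y \<in> V" and f: "smooth_on V f"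
  shows "laplacian G (grad_sq G f) y =
    2 * (\<Sum>l\<in>UNIV. \<Sum>k\<in>UNIV. \<Sum>j\<in>UNIV. \<Sum>i\<in>UNIV.
        h l k y * h j i y * hessian G f y $ l $ j * hessian G f y $ k $ i)
    + 2 * (\<Sum>j\<in>UNIV. gradient G f y $ j * pd j (laplacian G f) y)
    + 2 * (\<Sum>i\<in>UNIV. \<Sum>j\<in>UNIV. ricci G y $ i $ j * gradient G f y $ i * gradient G f y $ j)"
proof -
  let ?F = "\<lambda>j. gradient G f y $ j" and ?W = "\<lambda>k j y. hessian G f y $ k $ j"
  have tr: "(\<Sum>l\<in>UNIV. \<Sum>k\<in>UNIV. h l k y * cov_form2 l ?W k j y)
      = pd j (laplacian G f) y + (\<Sum>k\<in>UNIV. ?F k * ricci G y $ k $ j)" for j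
  proof -
    have "(\<Sum>l\<in>UNIV. \<Sum>k\<in>UNIV. h l k y * cov_form2 l ?W k j y)
      = (\<Sum>l\<in>UNIV. \<Sum>k\<in>UNIV. h l k y * cov_form2 j ?W l k y)
        + (\<Sum>l\<in>UNIV. \<Sum>k\<in>UNIV. h l k y * (\<Sum>p\<in>UNIV. pd p f y * curv p k j l y))"
      unfolding ricci_identity[OF y f, of _ _ j] by (simp add: distrib_left sum.distrib)
    also have "(\<Sum>l\<in>UNIV. \<Sum>k\<in>UNIV. h l k y * cov_form2 j ?W l k y) = pd j (laplacian G f) y"
      unfolding laplacian_def[abs_def] by (rule pd_trace[OF y smooth_hessian[OF f], symmetric])
    finally show ?thesis unfolding curvature_contraction[OF y] .
  qed
  have "laplacian G (grad_sq G f) y =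
      2 * (\<Sum>l\<in>UNIV. \<Sum>k\<in>UNIV. \<Sum>j\<in>UNIV. \<Sum>i\<in>UNIV. h l k y * h j i y * ?W l i y * ?W k j y)
      + 2 * (\<Sum>l\<in>UNIV. \<Sum>k\<in>UNIV. \<Sum>j\<in>UNIV. ?F j * (h l k y * cov_form2 l ?W k j y))"
    unfolding laplacian_def hessian_grad_sq[OF y f]
    by (simp add: sum.distrib sum_distrib_left sum_distrib_right algebra_simps)
  also have "(\<Sum>l\<in>UNIV. \<Sum>k\<in>UNIV. \<Sum>j\<in>UNIV. \<Sum>i\<in>UNIV. h l k y * h j i y * ?W l i y * ?W k j y)
     = (\<Sum>l\<in>UNIV. \<Sum>k\<in>UNIV. \<Sum>j\<in>UNIV. \<Sum>i\<in>UNIV. h l k y * h j i y * ?W l j y * ?W k i y)"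
    by (rule sum.cong[OF refl], rule sum.cong[OF refl], subst sum.swap) (simp only: h_sym[OF y])
  also have "(\<Sum>l\<in>UNIV. \<Sum>k\<in>UNIV. \<Sum>j\<in>UNIV. ?F j * (h l k y * cov_form2 l ?W k j y))
      = (\<Sum>j\<in>UNIV. ?F j * (\<Sum>l\<in>UNIV. \<Sum>k\<in>UNIV. h l k y * cov_form2 l ?W k j y))"
  proof -
    have "(\<Sum>l\<in>UNIV. \<Sum>k\<in>UNIV. \<Sum>j\<in>UNIV. ?F j * (h l k y * cov_form2 l ?W k j y))
      = (\<Sum>l\<in>UNIV. \<Sum>j\<in>UNIV. \<Sum>k\<in>UNIV. ?F j * (h l k y * cov_form2 l ?W k j y))"
      by (intro sum.cong refl sum.swap)
    also have "\<dots> = (\<Sum>j\<in>UNIV. \<Sum>l\<in>UNIV. \<Sum>k\<in>UNIV. ?F j * (h l k y * cov_form2 l ?W k j y))"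
      by (rule sum.swap)
    finally show ?thesis by (simp add: sum_distrib_left)
  qed
  also have "\<dots> = (\<Sum>j\<in>UNIV. ?F j * pd j (laplacian G f) y)
      + (\<Sum>i\<in>UNIV. \<Sum>j\<in>UNIV. ricci G y $ i $ j * ?F i * ?F j)"
  proof -
    have "(\<Sum>j\<in>UNIV. \<Sum>i\<in>UNIV. ricci G y $ i $ j * ?F i * ?F j)
        = (\<Sum>i\<in>UNIV. \<Sum>j\<in>UNIV. ricci G y $ i $ j * ?F i * ?F j)"
      by (rule sum.swap)
    then show ?thesis
      unfolding tr by (simp add: distrib_left sum.distrib sum_distrib_left mult_ac)
  qed
  finally show ?thesis by (simp add: distrib_left)
qed

end


section \<open>Second-order conditions at a spatial maximum\<close>

lemma linear_dd: "f differentiable (at x) \<Longrightarrow> linear (\<lambda>v. dd v f x)"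
  using has_derivative_dd has_derivative_linear by blast

lemma dd_eq_sum_pd:
  fixes f :: "real^'n \<Rightarrow> real"
  assumes "f differentiable (at x)"
  shows "dd v f x = (\<Sum>i\<in>UNIV. v $ i * pd i f x)"
proof -
  have "dd v f x = dd (\<Sum>i\<in>UNIV. v $ i *\<^sub>R axis i 1) f x"
    using basis_expansion[of v] by (simp add: scalar_mult_eq_scaleR)
  also have "\<dots> = (\<Sum>i\<in>UNIV. v $ i *\<^sub>R dd (axis i 1) f x)"
    by (simp add: linear_sum[OF linear_dd[OF assms]] linear_cmul[OF linear_dd[OF assms]])
  finally show ?thesis by (simp add: pd_eq_dd)
qed

lemma dd_at_local_max:
  assumes "open V" "y \<in> V" "f differentiable (at y)" "\<And>z. z \<in> V \<Longrightarrow> f z \<le> f y"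
  shows "dd v f y = 0"
  using differential_zero_maxmin[OF assms(2,1) has_derivative_dd[OF assms(3)]] assms(4)
  by (meson fun_cong)

text \<open>
  Otherwise the directional derivative, which vanishes at \<open>y\<close>, would be positive just after \<open>y\<close> on
  the line through \<open>y\<close> in direction \<open>v\<close>, and \<open>f\<close> would increase there.
\<close>

lemma second_dd_at_local_max:
  fixes f :: "'a::real_normed_vector \<Rightarrow> real"
  assumes V: "open V" and y: "y \<in> V" and f: "smooth_on V f" and max: "\<And>z. z \<in> V \<Longrightarrow> f z \<le> f y"
  shows "dd v (dd v f) y \<le> 0"
proof (rule ccontr)
  assume "\<not> dd v (dd v f) y \<le> 0"
  then have pos: "dd v (dd v f) y > 0" by simp
  let ?line = "\<lambda>s::real. y + s *\<^sub>R v"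
  have "open (?line -` V)"
    by (intro continuous_open_vimage V) (auto intro!: continuous_intros)
  moreover have "0 \<in> ?line -` V" using y by simp
  ultimately obtain d1 where d1: "d1 > 0" "ball 0 d1 \<subseteq> ?line -` V"
    using openE by blast
  have inV: "?line s \<in> V" if "\<bar>s\<bar> < d1" for s using d1(2) that by (auto simp: dist_real_def)
  have der1: "((\<lambda>s. f (?line s)) has_real_derivative dd v f (?line s)) (at s)" if "\<bar>s\<bar> < d1" for s
    by (rule line_has_derivative[OF smooth_on_differentiable[OF V f inV[OF that]]])
  have der2: "((\<lambda>s. dd v f (?line s)) has_real_derivative dd v (dd v f) y) (at 0)"
    using line_has_derivative[of "dd v f" y 0 v] smooth_on_differentiable[OF V smooth_on_dd[OF V f] y]
    by simp
  have "dd v f y = 0"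
    by (rule dd_at_local_max[OF V y smooth_on_differentiable[OF V f y] max])
  with DERIV_pos_inc_right[OF der2 pos] obtain d2 where d2: "d2 > 0"
    and inc: "\<And>s. 0 < s \<Longrightarrow> s < d2 \<Longrightarrow> dd v f (?line s) > 0" by auto
  define s where "s = min d1 d2 / 2"
  have s: "0 < s" "s < d1" "s < d2" using d1(1) d2 by (auto simp: s_def)
  obtain z where z: "0 < z" "z < s" and eq: "f (?line s) - f (?line 0) = (s - 0) * dd v f (?line z)"
    using MVT2[OF s(1), of "\<lambda>s. f (?line s)"] der1 s by force
  have "dd v f (?line z) > 0" using inc[of z] z s by simp
  then have "(s - 0) * dd v f (?line z) > 0" using s(1) by simp
  then have "f (?line s) > f y" using eq by simp
  moreover have "f (?line s) \<le> f y" using max inV[of s] s by simp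
  ultimately show False by simp
qed

lemma dd_dd_eq_quad:
  fixes f :: "real^'n \<Rightarrow> real"
  assumes V: "open V" and y: "y \<in> V" and f: "smooth_on V f"
  shows "dd v (dd v f) y = quad (\<lambda>i j. pd i (pd j f) y) (\<lambda>i. v $ i)"
proof -
  note d = smooth_on_differentiable[OF V]
  have "dd v (dd v f) y = dd v (\<lambda>z. \<Sum>j\<in>UNIV. v $ j * pd j f z) y"
    by (rule dd_cong_open[OF V y]) (rule dd_eq_sum_pd[OF d[OF f]])
  also have "\<dots> = (\<Sum>j\<in>UNIV. dd v (\<lambda>z. v $ j * pd j f z) y)"
    by (intro dd_sum d[OF _ y] smooth_intros V f)
  also have "\<dots> = (\<Sum>j\<in>UNIV. v $ j * dd v (pd j f) y)"
    by (intro sum.cong refl dd_cmult d[OF _ y] smooth_intros V f)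
  also have "\<dots> = (\<Sum>j\<in>UNIV. \<Sum>i\<in>UNIV. v $ j * (v $ i * pd i (pd j f) y))"
    by (simp add: dd_eq_sum_pd[OF d[OF smooth_on_pd[OF V f] y]] sum_distrib_left)
  also have "\<dots> = quad (\<lambda>i j. pd i (pd j f) y) (\<lambda>i. v $ i)"
    unfolding quad_def by (subst sum.swap) (simp add: mult_ac)
  finally show ?thesis .
qed

lemma (in metric_chart) h_psd: "y \<in> V \<Longrightarrow> quad (\<lambda>i j. h i j y) v \<ge> 0"
  unfolding ginv_def by (intro metric_inverse_psd metric_G)

text \<open>
  At a maximum the gradient vanishes, so the Christoffel terms of \<open>\<Delta>f\<close> do too; the left-hand side is
  \<open>\<Delta>f\<close> without them.
\<close>

lemma (in metric_chart) trace_hessian_at_local_max: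
  assumes y: "y \<in> V" and f: "smooth_on V f" and max: "\<And>z. z \<in> V \<Longrightarrow> f z \<le> f y"
  shows "(\<Sum>i\<in>UNIV. \<Sum>j\<in>UNIV. h i j y * pd i (pd j f) y) \<le> 0"
proof -
  have "quad (\<lambda>i j. - pd i (pd j f) y) v \<ge> 0" for v
  proof -
    have "quad (\<lambda>i j. - pd i (pd j f) y) v = - quad (\<lambda>i j. pd i (pd j f) y) (\<lambda>i. (\<chi> i. v i) $ i)"
      by (simp add: quad_def sum_negf)
    also have "\<dots> = - dd (\<chi> i. v i) (dd (\<chi> i. v i) f) y"
      using dd_dd_eq_quad[OF open_V y f, of "\<chi> i. v i"] by simp
    also have "\<dots> \<ge> 0" using second_dd_at_local_max[OF open_V y f max] by simp
    finally show ?thesis .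
  qed
  then have "0 \<le> (\<Sum>i\<in>UNIV. \<Sum>j\<in>UNIV. h i j y * - pd i (pd j f) y)"
    by (intro psd_contraction_nonneg h_sym h_psd y)
  then show ?thesis by (simp add: sum_negf)
qed

section \<open>Logarithmic transform\<close>

text \<open>
  The logarithm turns the heat equation into \<open>\<partial>\<^sub>t f = \<Delta> f - |\<nabla>f|\<^sup>2\<close>. For \<open>L = ln A\<close> the function is
  \<open>ln (A / u)\<close>.
\<close>

lemma (in metric_chart) log_transform:
  assumes y: "y \<in> V" and u: "smooth_on V u" and pos: "\<And>z. z \<in> V \<Longrightarrow> u z > 0"
  shows "smooth_on V (\<lambda>y. L - ln (u y))"
    and "grad_sq G (\<lambda>y. L - ln (u y)) y = grad_sq G u y / (u y)\<^sup>2"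
    and "laplacian G (\<lambda>y. L - ln (u y)) y = - laplacian G u y / u y + grad_sq G u y / (u y)\<^sup>2"
proof -
  let ?f = "\<lambda>y. L - ln (u y)"
  have nz: "u z \<noteq> 0" if "z \<in> V" for z using pos[OF that] by simp
  have iu: "smooth_on V (\<lambda>y. inverse (u y))" by (rule smooth_on_inverse[OF open_V u nz])
  have lnu: "smooth_on V (\<lambda>y. ln (u y))" by (rule smooth_on_ln[OF open_V u pos])
  then show "smooth_on V ?f" by (intro smooth_intros open_V)
  have pd1: "pd j ?f z = - 1 * (pd j u z * inverse (u z))" if "z \<in> V" for j z
    unfolding pd_diff[OF that smooth_on_const[OF open_V] lnu]
    by (simp add: pd_eq_dd dd_ln[OF differentiable_V[OF that u] pos[OF that]])
  have pd_inv: "pd i (\<lambda>y. inverse (u y)) y = - (pd i u y * inverse (u y) * inverse (u y))" for i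
    unfolding pd_eq_dd by (rule dd_inverse[OF differentiable_V[OF y u] nz[OF y]])
  have pd2: "pd i (pd j ?f) y = - pd i (pd j u) y * inverse (u y) + pd i u y * pd j u y * inverse (u y) * inverse (u y)"
    for i j
  proof -
    have "pd i (pd j ?f) y = pd i (\<lambda>z. - 1 * (pd j u z * inverse (u z))) y"
      by (rule pd_cong[OF y pd1])
    also have "\<dots> = - 1 * pd i (\<lambda>z. pd j u z * inverse (u z)) y"
      by (intro pd_cmult y smooth_intros open_V u iu)
    also have "pd i (\<lambda>z. pd j u z * inverse (u z)) y
      = pd i (pd j u) y * inverse (u y) + pd j u y * pd i (\<lambda>z. inverse (u z)) y"
      by (intro pd_mult y smooth_intros open_V u iu)
    finally show ?thesis unfolding pd_inv by (simp add: algebra_simps)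
  qed
  show "grad_sq G ?f y = grad_sq G u y / (u y)\<^sup>2"
    unfolding grad_sq_def pd1[OF y] sum_divide_distrib
    by (simp add: field_simps power2_eq_square nz[OF y])
  have hess: "hessian G ?f y $ i $ j = - hessian G u y $ i $ j / u y + pd i u y * pd j u y / (u y)\<^sup>2" for i j
    unfolding hessian_def pd2 pd1[OF y]
    by (simp add: field_simps power2_eq_square nz[OF y] sum_distrib_left sum_negf sum_divide_distrib)
  have "laplacian G ?f y = (\<Sum>i\<in>UNIV. \<Sum>j\<in>UNIV. - (h i j y * hessian G u y $ i $ j) / u y
      + h i j y * pd i u y * pd j u y / (u y)\<^sup>2)"
    unfolding laplacian_def hess by (simp add: algebra_simps)
  also have "\<dots> = - laplacian G u y / u y + grad_sq G u y / (u y)\<^sup>2"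
    unfolding laplacian_def grad_sq_def sum.distrib sum_divide_distrib sum_negf[symmetric] ..
  finally show "laplacian G ?f y = - laplacian G u y / u y + grad_sq G u y / (u y)\<^sup>2" .
qed

section \<open>Evolution of the gradient quantity\<close>

lemma pd_slice:
  fixes F :: "(real^'n) \<times> real \<Rightarrow> real"
  assumes "F differentiable (at (y, t))"
  shows "pd i (\<lambda>y. F (y, t)) y = dd (axis i 1, 0) F (y, t)"
  using slice_has_derivative[of UNIV y t UNIV F] assms
  unfolding pd_eq_dd by (intro dd_eqI[THEN trans]) (auto simp: dd_def)

lemma time_slice:
  fixes F :: "(real^'n) \<times> real \<Rightarrow> real"
  assumes "F differentiable (at (y, t))"
  shows "((\<lambda>s. F (y, s)) has_real_derivative dd (0, 1) F (y, t)) (at t)"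
proof -
  have "((\<lambda>s. F ((y, 0) + s *\<^sub>R (0, 1))) has_real_derivative dd (0, 1) F ((y, 0) + t *\<^sub>R (0, 1))) (at t)"
    by (rule line_has_derivative) (use assms in simp)
  then show ?thesis by simp
qed

text \<open>
  Symmetry of second derivatives in space-time: if \<open>\<partial>\<^sub>t F = P\<close> at time \<open>t\<close>, then
  \<open>\<partial>\<^sub>t \<partial>\<^sub>j F = \<partial>\<^sub>j P\<close>.
\<close>

lemma time_derivative_spatial:
  fixes F :: "(real^'n) \<times> real \<Rightarrow> real"
  assumes V: "open V" and I: "open I" and y: "y \<in> V" and t: "t \<in> I"
    and F: "smooth_on (V \<times> I) F"
    and heat: "\<And>z. z \<in> V \<Longrightarrow> dd (0, 1) F (z, t) = P z"
  shows "((\<lambda>s. pd j (\<lambda>y. F (y, s)) y) has_real_derivative pd j P y) (at t)"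
proof -
  have S: "open (V \<times> I)" using V I by (rule open_Times)
  note d = smooth_on_differentiable[OF S]
  have "pd j P y = pd j (\<lambda>z. dd (0, 1) F (z, t)) y"
    unfolding pd_eq_dd by (rule dd_cong_open[OF V y]) (simp add: heat)
  also have "\<dots> = dd (axis j 1, 0) (dd (0, 1) F) (y, t)"
    by (intro pd_slice d smooth_on_dd[OF S F]) (use y t in auto)
  also have "\<dots> = dd (0, 1) (dd (axis j 1, 0) F) (y, t)"
    by (rule dd_commute[OF S F]) (use y t in auto)
  finally have eq: "dd (0, 1) (dd (axis j 1, 0) F) (y, t) = pd j P y" by simp
  have "((\<lambda>s. dd (axis j 1, 0) F (y, s)) has_real_derivative pd j P y) (at t)"
    unfolding eq[symmetric]
    by (intro time_slice d smooth_on_dd[OF S F]) (use y t in auto)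
  then show ?thesis
  proof (rule has_field_derivative_transform_within_open[OF _ I t])
    show "dd (axis j 1, 0) F (y, s) = pd j (\<lambda>y. F (y, s)) y" if "s \<in> I" for s
      by (intro pd_slice[symmetric] d F) (use y that in auto)
  qed
qed

text \<open>
  \<open>H\<^sup>2(v, v)\<close> is the squared length of \<open>i\<^sub>v H\<close>.
\<close>

lemma quad_three_form_sq:
  "quad (\<lambda>i j. three_form_sq G \<eta> y $ i $ j) v =
    (\<Sum>k\<in>UNIV. \<Sum>l\<in>UNIV. \<Sum>p\<in>UNIV. \<Sum>q\<in>UNIV. ginv G y k l * ginv G y p q
      * (\<Sum>i\<in>UNIV. \<eta> y $ i $ k $ p * v i) * (\<Sum>i\<in>UNIV. \<eta> y $ i $ l $ q * v i))"
proof -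
  have "quad (\<lambda>i j. three_form_sq G \<eta> y $ i $ j) v = (\<Sum>i\<in>UNIV. \<Sum>j\<in>UNIV. \<Sum>k\<in>UNIV. \<Sum>l\<in>UNIV. \<Sum>p\<in>UNIV. \<Sum>q\<in>UNIV.
      ginv G y k l * ginv G y p q * (\<eta> y $ i $ k $ p * v i) * (\<eta> y $ j $ l $ q * v j))"
    unfolding quad_def three_form_sq_def by (simp add: sum_distrib_left sum_distrib_right mult_ac)
  also have "\<dots> = (\<Sum>k\<in>UNIV. \<Sum>l\<in>UNIV. \<Sum>i\<in>UNIV. \<Sum>j\<in>UNIV. \<Sum>p\<in>UNIV. \<Sum>q\<in>UNIV.
      ginv G y k l * ginv G y p q * (\<eta> y $ i $ k $ p * v i) * (\<eta> y $ j $ l $ q * v j))"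
    by (rule sum_swap_pairs)
  also have "\<dots> = (\<Sum>k\<in>UNIV. \<Sum>l\<in>UNIV. \<Sum>p\<in>UNIV. \<Sum>q\<in>UNIV. \<Sum>i\<in>UNIV. \<Sum>j\<in>UNIV.
      ginv G y k l * ginv G y p q * (\<eta> y $ i $ k $ p * v i) * (\<eta> y $ j $ l $ q * v j))"
    by (rule sum.cong[OF refl], rule sum.cong[OF refl], rule sum_swap_pairs)
  finally show ?thesis
    by (simp add: sum_distrib_left sum_distrib_right mult_ac)
qed

lemma (in metric_chart) three_form_sq_psd:
  "y \<in> V \<Longrightarrow> quad (\<lambda>i j. three_form_sq G \<eta> y $ i $ j) v \<ge> 0"
  unfolding quad_three_form_sq by (intro psd_double_contraction_nonneg h_sym h_psd)

text \<open>
  Evaluating \<open>g\<inverse> B g\<inverse>\<close> on \<open>df\<close> is evaluating \<open>B\<close> on \<open>\<nabla>f\<close>; with \<open>B = \<partial>\<^sub>t g\<close> this is, up to sign,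
  the contribution of the moving metric to \<open>\<partial>\<^sub>t |\<nabla>f|\<^sup>2\<close>.
\<close>

lemma (in metric_chart) inverse_metric_contraction:
  assumes y: "y \<in> V"
  shows "(\<Sum>i\<in>UNIV. \<Sum>j\<in>UNIV. (\<Sum>a\<in>UNIV. \<Sum>b\<in>UNIV. h i a y * B a b * h b j y) * pd i f y * pd j f y)
    = quad B (\<lambda>i. gradient G f y $ i)"
proof -
  have "(\<Sum>i\<in>UNIV. \<Sum>j\<in>UNIV. (\<Sum>a\<in>UNIV. \<Sum>b\<in>UNIV. h i a y * B a b * h b j y) * pd i f y * pd j f y)
    = (\<Sum>i\<in>UNIV. \<Sum>j\<in>UNIV. \<Sum>a\<in>UNIV. \<Sum>b\<in>UNIV. B a b * (h a i y * pd i f y) * (h b j y * pd j f y))"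
    by (intro sum.cong refl) (simp add: sum_distrib_left sum_distrib_right h_sym[OF y] mult_ac)
  also have "\<dots> = (\<Sum>a\<in>UNIV. \<Sum>b\<in>UNIV. \<Sum>i\<in>UNIV. \<Sum>j\<in>UNIV. B a b * (h a i y * pd i f y) * (h b j y * pd j f y))"
    by (rule sum_swap_pairs)
  finally show ?thesis
    by (simp add: quad_def gradient_raise sum_distrib_left sum_distrib_right mult_ac)
qed

text \<open>
  Writing \<open>Q = |\<nabla>f|\<^sup>2\<close>, \<open>\<Psi> = t Q - f\<close> and \<open>K\<close> for the tensor \<open>H\<^sup>2\<close>, the derivative is
  \<open>D = Q + t (2 Ric(\<nabla>f, \<nabla>f) - K(\<nabla>f, \<nabla>f) / 2 + 2 \<langle>\<nabla>f, \<nabla>(\<Delta>f - Q)\<rangle>) - (\<Delta>f - Q)\<close>. At a critical point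
  \<open>t \<nabla>Q = \<nabla>f\<close>, hence \<open>2 t \<langle>\<nabla>f, \<nabla>Q\<rangle> = 2 Q\<close> cancels the two other occurrences of \<open>Q\<close>. Comparing
  with the Bochner formula leaves \<open>\<Delta>\<Psi> - D = 2 t |\<nabla>\<^sup>2 f|\<^sup>2 + t K(\<nabla>f, \<nabla>f) / 2 \<ge> 0\<close>.
\<close>

lemma evolution_at_critical_point:
  fixes G :: "real \<Rightarrow> real^'n \<Rightarrow> real^'n^'n" and f :: "real \<Rightarrow> real^'n \<Rightarrow> real" and K :: "'n \<Rightarrow> 'n \<Rightarrow> real"
  assumes V: "open V" and I: "open I" and y: "y \<in> V" and t: "t \<in> I" "t > 0"
    and G: "\<And>i j. smooth_on (V \<times> I) (\<lambda>(y, t). G t y $ i $ j)"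
    and metric: "\<And>y t. y \<in> V \<Longrightarrow> t \<in> I \<Longrightarrow> metric_matrix (G t y)"
    and f: "smooth_on (V \<times> I) (\<lambda>(y, t). f t y)"
    and flow: "\<And>i j. ((\<lambda>s. G s y $ i $ j) has_real_derivative
        (- 2 * ricci (G t) y $ i $ j + (1/2) * K i j)) (at t)"
    and K: "\<And>v. quad K v \<ge> 0"
    and heat: "\<And>y. y \<in> V \<Longrightarrow>
        ((\<lambda>s. f s y) has_real_derivative laplacian (G t) (f t) y - grad_sq (G t) (f t) y) (at t)"
    and crit: "\<And>k. pd k (\<lambda>y. t * grad_sq (G t) (f t) y - f t y) y = 0"
  shows "\<exists>D. ((\<lambda>s. s * grad_sq (G s) (f s) y - f s y) has_real_derivative D) (at t) \<and>
    D \<le> (\<Sum>i\<in>UNIV. \<Sum>j\<in>UNIV. ginv (G t) y i j * pd i (pd j (\<lambda>y. t * grad_sq (G t) (f t) y - f t y)) y)"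
proof -
  let ?F = "\<lambda>(y, t). f t y" and ?G = "\<lambda>i j (y, t). G t y $ i $ j"
  have S: "open (V \<times> I)" using V I by (rule open_Times)
  have yt: "(y, t) \<in> V \<times> I" using y t by simp
  interpret metric_chart V "G t"
    using V smooth_on_slice[OF V t(1) G] metric[OF _ t(1)] by unfold_locales auto
  have ft: "smooth_on V (f t)" using smooth_on_slice[OF V t(1) f] by simp
  let ?Q = "grad_sq (G t) (f t)" and ?\<Delta> = "laplacian (G t) (f t)"
  let ?v = "\<lambda>i. gradient (G t) (f t) y $ i" and ?R = "\<lambda>i j. ricci (G t) y $ i $ j"
  have Q: "smooth_on V ?Q" and L: "smooth_on V ?\<Delta>"
    by (rule smooth_grad_sq[OF ft], rule smooth_laplacian[OF ft])
  have ddF: "dd (0, 1) ?F (z, t) = ?\<Delta> z - ?Q z" if "z \<in> V" for z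
  proof -
    have "((\<lambda>s. ?F (z, s)) has_real_derivative dd (0, 1) ?F (z, t)) (at t)"
      by (intro time_slice smooth_on_differentiable[OF S f]) (use that t in auto)
    then show ?thesis using DERIV_unique heat[OF that] by fastforce
  qed
  have df: "((\<lambda>s. pd j (f s) y) has_real_derivative pd j ?\<Delta> y - pd j ?Q y) (at t)" for j
    using time_derivative_spatial[OF V I y t(1) f ddF, of j] by (simp add: pd_diff[OF y L Q])
  define dh where "dh i j = - (\<Sum>a\<in>UNIV. \<Sum>b\<in>UNIV. h i a y * (- 2 * ?R a b + (1/2) * K a b) * h b j y)" for i j
  have dh: "((\<lambda>s. ginv (G s) y i j) has_real_derivative dh i j) (at t)" for i j
  proof -
    let ?M = "\<lambda>z. G (snd z) (fst z)"
    have M: "smooth_on (V \<times> I) (\<lambda>z. ?M z $ i $ j)" for i j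
      using G[of i j] by (simp add: case_prod_beta')
    have inv: "invertible (?M z)" if "z \<in> V \<times> I" for z
      using metric_matrix_invertible[OF metric[of "fst z" "snd z"]] that by auto
    have dM: "dd (0, 1) (\<lambda>z. ?M z $ a $ b) (y, t) = - 2 * ?R a b + (1/2) * K a b" for a b
    proof -
      have "((\<lambda>s. ?M (y, s) $ a $ b) has_real_derivative dd (0, 1) (\<lambda>z. ?M z $ a $ b) (y, t)) (at t)"
        by (rule time_slice[OF smooth_on_differentiable[OF S M yt]])
      then show ?thesis using DERIV_unique flow[of a b] by fastforce
    qed
    have "((\<lambda>s. matrix_inv (?M (y, s)) $ i $ j) has_real_derivative dd (0, 1) (\<lambda>z. matrix_inv (?M z) $ i $ j) (y, t)) (at t)"
      by (intro time_slice smooth_on_differentiable[OF S _ yt] smooth_on_matrix_inv S M inv)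
    moreover have "dd (0, 1) (\<lambda>z. matrix_inv (?M z) $ i $ j) (y, t) = dh i j"
      using dd_matrix_inv[where M="?M", OF S M inv yt, of "(0, 1)" i j]
      unfolding dM dh_def ginv_def by (simp only: fst_conv snd_conv)
    ultimately show ?thesis by (simp add: ginv_def)
  qed
  have dQ: "((\<lambda>s. grad_sq (G s) (f s) y) has_real_derivative
      (\<Sum>i\<in>UNIV. \<Sum>j\<in>UNIV. dh i j * pd i (f t) y * pd j (f t) y
        + h i j y * (pd i ?\<Delta> y - pd i ?Q y) * pd j (f t) y
        + h i j y * pd i (f t) y * (pd j ?\<Delta> y - pd j ?Q y))) (at t)"
    unfolding grad_sq_def[of _ _ y]
    by (auto intro!: derivative_eq_intros dh df sum.cong simp: algebra_simps)
  have c1: "(\<Sum>i\<in>UNIV. \<Sum>j\<in>UNIV. h i j y * pd i (f t) y * a j) = (\<Sum>j\<in>UNIV. ?v j * a j)" for a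
    by (subst sum.swap) (simp add: gradient_raise sum_distrib_right h_sym[OF y])
  have c2: "(\<Sum>i\<in>UNIV. \<Sum>j\<in>UNIV. h i j y * a i * pd j (f t) y) = (\<Sum>j\<in>UNIV. ?v j * a j)" for a
    by (simp add: gradient_raise sum_distrib_left sum_distrib_right mult_ac)
  have c3: "(\<Sum>i\<in>UNIV. \<Sum>j\<in>UNIV. dh i j * pd i (f t) y * pd j (f t) y) = 2 * quad ?R ?v - (1/2) * quad K ?v"
  proof -
    have "(\<Sum>i\<in>UNIV. \<Sum>j\<in>UNIV. dh i j * pd i (f t) y * pd j (f t) y)
      = - quad (\<lambda>a b. - 2 * ?R a b + (1/2) * K a b) ?v"
      unfolding inverse_metric_contraction[OF y, symmetric] dh_def by (simp add: sum_negf)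
    also have "\<dots> = 2 * quad ?R ?v - (1/2) * quad K ?v"
      unfolding quad_def by (simp add: algebra_simps sum.distrib sum_subtractf sum_distrib_left)
    finally show ?thesis .
  qed
  define N where "N = (\<Sum>l\<in>UNIV. \<Sum>k\<in>UNIV. \<Sum>j\<in>UNIV. \<Sum>i\<in>UNIV.
        h l k y * h j i y * hessian (G t) (f t) y $ l $ j * hessian (G t) (f t) y $ k $ i)"
  have N: "N \<ge> 0"
    unfolding N_def
    by (intro psd_double_contraction_nonneg h_sym h_psd y)
  define FD where "FD = (\<Sum>j\<in>UNIV. ?v j * pd j ?\<Delta> y)"
  define FQ where "FQ = (\<Sum>j\<in>UNIV. ?v j * pd j ?Q y)"
  define D where "D = ?Q y + t * (2 * quad ?R ?v - (1/2) * quad K ?v + 2 * (FD - FQ)) - (?\<Delta> y - ?Q y)"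
  have "((\<lambda>s. s * grad_sq (G s) (f s) y - f s y) has_real_derivative D) (at t)"
  proof -
    have "(\<Sum>i\<in>UNIV. \<Sum>j\<in>UNIV. dh i j * pd i (f t) y * pd j (f t) y
        + h i j y * (pd i ?\<Delta> y - pd i ?Q y) * pd j (f t) y
        + h i j y * pd i (f t) y * (pd j ?\<Delta> y - pd j ?Q y))
      = 2 * quad ?R ?v - (1/2) * quad K ?v + 2 * (FD - FQ)"
      unfolding sum.distrib c1 c2 c3 FD_def FQ_def
      by (simp add: right_diff_distrib sum_subtractf)
    with dQ have "((\<lambda>s. grad_sq (G s) (f s) y) has_real_derivative
       2 * quad ?R ?v - (1/2) * quad K ?v + 2 * (FD - FQ)) (at t)" by simp
    from DERIV_diff[OF DERIV_mult[OF DERIV_ident this] heat[OF y]]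
    show ?thesis by (simp add: D_def algebra_simps)
  qed
  moreover have "D \<le> (\<Sum>i\<in>UNIV. \<Sum>j\<in>UNIV. h i j y * pd i (pd j (\<lambda>y. t * ?Q y - f t y)) y)"
  proof -
    have pd1: "pd j (\<lambda>y. t * ?Q y - f t y) z = t * pd j ?Q z - pd j (f t) z" if "z \<in> V" for j z
      by (subst pd_diff pd_cmult, (intro that smooth_intros open_V Q ft)+)+ simp
    have pd2: "pd i (pd j (\<lambda>y. t * ?Q y - f t y)) y = t * pd i (pd j ?Q) y - pd i (pd j (f t)) y" for i j
    proof -
      have "pd i (pd j (\<lambda>y. t * ?Q y - f t y)) y = pd i (\<lambda>z. t * pd j ?Q z - pd j (f t) z) y"
        by (rule pd_cong[OF y pd1])
      also have "\<dots> = t * pd i (pd j ?Q) y - pd i (pd j (f t)) y"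
        by (subst pd_diff pd_cmult, (intro y smooth_intros open_V Q ft)+)+ simp
      finally show ?thesis .
    qed
    \<comment> \<open>Because of this identity the Christoffel terms in \<open>t \<Delta>Q - \<Delta>f\<close> cancel.\<close>
    have tQ: "t * pd k ?Q y = pd k (f t) y" for k using crit[of k] pd1[OF y] by simp
    have hs: "pd i (pd j (\<lambda>y. t * ?Q y - f t y)) y
        = t * hessian (G t) ?Q y $ i $ j - hessian (G t) (f t) y $ i $ j" for i j
      unfolding pd2 hessian_def
      by (simp add: right_diff_distrib sum_distrib_left tQ mult.left_commute[of t])
    have "(\<Sum>i\<in>UNIV. \<Sum>j\<in>UNIV. h i j y * pd i (pd j (\<lambda>y. t * ?Q y - f t y)) y) = t * laplacian (G t) ?Q y - ?\<Delta> y"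
      unfolding hs laplacian_def by (simp add: algebra_simps sum_subtractf sum_distrib_left)
    also have "laplacian (G t) ?Q y = 2 * N + 2 * FD + 2 * quad ?R ?v"
      unfolding bochner[OF y ft] N_def FD_def quad_def ..
    finally have rhs: "(\<Sum>i\<in>UNIV. \<Sum>j\<in>UNIV. h i j y * pd i (pd j (\<lambda>y. t * ?Q y - f t y)) y)
      = t * (2 * N + 2 * FD + 2 * quad ?R ?v) - ?\<Delta> y" .
    have "t * FQ = (\<Sum>j\<in>UNIV. ?v j * (t * pd j ?Q y))"
      by (simp add: FQ_def sum_distrib_left mult_ac)
    also have "\<dots> = ?Q y" by (simp add: tQ grad_sq_gradient)
    finally have FQ: "t * FQ = ?Q y" .
    have "0 \<le> t * (2 * N + (1/2) * quad K ?v)" using N K[of ?v] t(2) by simp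
    then show ?thesis
      unfolding rhs D_def using FQ by (simp add: algebra_simps)
  qed
  ultimately show ?thesis by blast
qed


section \<open>The weak maximum principle\<close>

text \<open>
  Subtracting \<open>e t\<close> makes the inequality strict: where \<open>\<Psi> - e t\<close> attains a positive maximum over
  \<open>[0, T] \<times> X\<close>, the time is positive by the initial condition and \<open>\<partial>\<^sub>t (\<Psi> - e t) \<le> - e < 0\<close>, so that
  slightly earlier values would be larger.
\<close>

lemma weak_maximum_principle:
  fixes \<Psi> :: "real \<Rightarrow> 'a \<Rightarrow> real"
  assumes X: "compact_space X" and T: "T > 0"
    and cont: "continuous_map (prod_topology (top_of_set {0..T}) X) euclideanreal (\<lambda>(t, p). \<Psi> t p)"
    and init: "\<And>p. p \<in> topspace X \<Longrightarrow> \<Psi> 0 p \<le> 0"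
    and deriv: "\<And>t p. 0 < t \<Longrightarrow> t \<le> T \<Longrightarrow> p \<in> topspace X \<Longrightarrow>
      (\<And>q. q \<in> topspace X \<Longrightarrow> \<Psi> t q \<le> \<Psi> t p) \<Longrightarrow>
      \<exists>D \<le> 0. ((\<lambda>s. \<Psi> s p) has_real_derivative D) (at t)"
    and t: "t \<in> {0..T}" and p: "p \<in> topspace X"
  shows "\<Psi> t p \<le> 0"
proof (rule ccontr)
  assume "\<not> \<Psi> t p \<le> 0"
  then have pos: "\<Psi> t p > 0" by simp
  \<comment> \<open>Small enough for \<open>\<Psi> - e t\<close> to be still positive at the given point.\<close>
  define e where "e = \<Psi> t p / (2 * T)"
  have e: "e > 0" using pos T by (simp add: e_def)
  let ?P = "prod_topology (top_of_set {0..T}) X"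
  let ?f = "\<lambda>(t, p). \<Psi> t p - e * t"
  have tP: "topspace ?P = {0..T} \<times> topspace X" by simp
  have "continuous_map ?P euclideanreal (\<lambda>z. (case z of (t, p) \<Rightarrow> \<Psi> t p) - e * fst z)"
  proof (rule continuous_map_diff[OF cont])
    have "continuous_map (top_of_set {0..T}) euclideanreal (\<lambda>t. e * t)"
      by (auto intro!: continuous_intros)
    from continuous_map_compose[OF continuous_map_fst this, of X]
    show "continuous_map ?P euclideanreal (\<lambda>z. e * fst z)" by (simp add: o_def)
  qed
  then have contf: "continuous_map ?P euclideanreal ?f"
    by (simp add: case_prod_beta')
  have "compact_space ?P"
    using X by (simp add: compact_space_prod_topology compact_space_subtopology)
  then have "compact (?f ` ({0..T} \<times> topspace X))"
    using image_compactin[OF _ contf, of "topspace ?P"] unfolding compact_space_def tP by simp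
  moreover have "?f ` ({0..T} \<times> topspace X) \<noteq> {}" using t p by blast
  ultimately obtain m where m: "m \<in> ?f ` ({0..T} \<times> topspace X)"
    and mx: "\<forall>z \<in> ?f ` ({0..T} \<times> topspace X). z \<le> m"
    using compact_attains_sup by blast
  then obtain t0 p0 where tp0: "t0 \<in> {0..T}" "p0 \<in> topspace X" "m = \<Psi> t0 p0 - e * t0" by auto
  have max: "\<Psi> s q - e * s \<le> \<Psi> t0 p0 - e * t0" if "s \<in> {0..T}" "q \<in> topspace X" for s q
    using mx that tp0(3) by auto
  have "e * t \<le> \<Psi> t p / 2"
  proof -
    have "e * t \<le> e * T" using e t by simp
    also have "\<dots> = \<Psi> t p / 2" using T by (simp add: e_def)
    finally show ?thesis .
  qed
  then have m_pos: "\<Psi> t0 p0 - e * t0 > 0" using max[OF t p] pos by linarith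
  have t0: "t0 > 0"
  proof (rule ccontr)
    assume "\<not> t0 > 0"
    then have "t0 = 0" using tp0(1) by simp
    then show False using m_pos init[OF tp0(2)] by simp
  qed
  have "\<exists>D \<le> 0. ((\<lambda>s. \<Psi> s p0) has_real_derivative D) (at t0)"
    using tp0 t0 max[OF tp0(1)] by (intro deriv) auto
  then obtain D where D: "D \<le> 0" "((\<lambda>s. \<Psi> s p0) has_real_derivative D) (at t0)" by blast
  have "((\<lambda>s. \<Psi> s p0 - e * s) has_real_derivative D - e) (at t0)"
    using D(2) by (auto intro!: derivative_eq_intros)
  moreover have "D - e < 0" using D(1) e by simp
  ultimately obtain d where d: "d > 0"
    and dec: "\<And>k. 0 < k \<Longrightarrow> k < d \<Longrightarrow> \<Psi> t0 p0 - e * t0 < \<Psi> (t0 - k) p0 - e * (t0 - k)"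
    using DERIV_neg_dec_left by blast
  define k where "k = min d t0 / 2"
  have k: "0 < k" "k < d" "k < t0" using d t0 by (auto simp: k_def)
  show False
    using dec[OF k(1,2)] max[of "t0 - k" p0] k tp0 by auto
qed

section \<open>Charts\<close>

lemma is_chartD:
  assumes c: "is_chart X c"
  shows chart_open: "openin X (fst c)"
    and chart_image_open: "open (chart_image c)"
    and chart_inj: "inj_on (snd c) (fst c)"
    and chart_continuous: "continuous_map (subtopology X (fst c)) (top_of_set (chart_image c)) (snd c)"
    and chart_open_image: "openin X U \<Longrightarrow> open (snd c ` (fst c \<inter> U))"
proof -
  show op: "openin X (fst c)" and V: "open (chart_image c)"
    using c unfolding is_chart_def by auto
  have hm: "homeomorphic_map (subtopology X (fst c)) (top_of_set (chart_image c)) (snd c)"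
    using c unfolding is_chart_def by auto
  have ts: "topspace (subtopology X (fst c)) = fst c"
    using openin_subset[OF op] by auto
  show "inj_on (snd c) (fst c)"
    using homeomorphic_imp_injective_map[OF hm] unfolding ts .
  show "continuous_map (subtopology X (fst c)) (top_of_set (chart_image c)) (snd c)"
    by (rule homeomorphic_imp_continuous_map[OF hm])
  show "open (snd c ` (fst c \<inter> U))" if "openin X U"
  proof -
    have "openin (subtopology X (fst c)) (fst c \<inter> U)"
      using that by (simp add: openin_subtopology_Int2)
    then have "openin (top_of_set (chart_image c)) (snd c ` (fst c \<inter> U))"
      using homeomorphic_imp_open_map[OF hm] unfolding open_map_def by blast
    then show ?thesis using V openin_open_trans by blast
  qed
qed

lemma chart_inv_chart: "is_chart X c \<Longrightarrow> p \<in> fst c \<Longrightarrow> chart_inv c (snd c p) = p"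
  by (simp add: chart_inv_def chart_inj)

lemma local_rep_chart: "is_chart X c \<Longrightarrow> p \<in> fst c \<Longrightarrow> local_rep f c (snd c p) = f p"
  by (simp add: local_rep_def chart_inv_chart)

text \<open>
  How the inverse metric and a covector behave under a change of coordinates with Jacobian \<open>J\<close>: the
  length of the covector does not change. \<open>J\<close> is invertible because \<open>P\<close> is.
\<close>

lemma inverse_congruence:
  fixes P Q J :: "real^'n^'n" and a b :: "real^'n"
  assumes P: "metric_matrix P" and Q: "metric_matrix Q"
    and PQ: "P = transpose J ** Q ** J" and a: "a = transpose J *v b"
  shows "a \<bullet> (matrix_inv P *v a) = b \<bullet> (matrix_inv Q *v b)"
proof -
  note iP = matrix_inv_inverse[OF metric_matrix_invertible[OF P]]
  note iQ = matrix_inv_inverse[OF metric_matrix_invertible[OF Q]]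
  let ?F = "matrix_inv P *v a"
  have left: "(matrix_inv P ** transpose J ** Q) ** J = mat 1"
    using iP(2) unfolding PQ by (simp only: matrix_mul_assoc)
  then obtain B where "J ** B = mat 1"
    using matrix_left_right_inverse by blast
  then have B: "transpose B ** transpose J = mat 1"
    by (metis matrix_transpose_mul transpose_mat)
  have "(transpose J ** Q ** J) *v x = transpose J *v (Q *v (J *v x))" for x
    by (simp only: matrix_vector_mul_assoc matrix_mul_assoc)
  then have "transpose J *v (Q *v (J *v ?F)) = P *v ?F"
    unfolding PQ[symmetric] by (rule sym)
  also have "P *v ?F = (P ** matrix_inv P) *v a"
    by (rule matrix_vector_mul_assoc)
  also have "\<dots> = transpose J *v b"
    by (simp only: iP matrix_vector_mul_lid a)
  finally have "transpose B *v (transpose J *v (Q *v (J *v ?F))) = transpose B *v (transpose J *v b)"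
    by simp
  moreover have "transpose B *v (transpose J *v x) = x" for x
    by (simp only: matrix_vector_mul_assoc B matrix_vector_mul_lid)
  ultimately have "Q *v (J *v ?F) = b" by (simp only:)
  moreover have "matrix_inv Q *v (Q *v x) = x" for x
    by (simp only: matrix_vector_mul_assoc iQ matrix_vector_mul_lid)
  ultimately have "matrix_inv Q *v b = J *v ?F" by metis
  then have "b \<bullet> (matrix_inv Q *v b) = b \<bullet> (J *v ?F)" by simp
  also have "\<dots> = (transpose J *v b) \<bullet> ?F"
    by (simp add: dot_lmul_matrix)
  finally show ?thesis by (simp add: a)
qed

lemma grad_sq_matrix:
  "grad_sq G f y = (\<chi> i. pd i f y) \<bullet> (matrix_inv (G y) *v (\<chi> i. pd i f y))"
  by (simp add: inner_matrix_quad quad_def grad_sq_def ginv_def)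

lemma metric_norm_gradient:
  fixes G :: "real^'n \<Rightarrow> real^'n^'n"
  assumes "metric_matrix (G y)"
  shows "(metric_norm G y (gradient G f y))\<^sup>2 = grad_sq G f y"
proof -
  let ?b = "\<chi> i. pd i f y"
  note inv = matrix_inv_inverse[OF metric_matrix_invertible[OF assms]]
  have v: "gradient G f y = matrix_inv (G y) *v ?b"
    by (simp add: gradient_def ginv_def matrix_vector_mult_def)
  have "(\<Sum>i\<in>UNIV. \<Sum>j\<in>UNIV. G y $ i $ j * gradient G f y $ i * gradient G f y $ j)
     = gradient G f y \<bullet> (G y *v gradient G f y)"
    by (simp add: inner_matrix_quad quad_def)
  also have "\<dots> = grad_sq G f y"
    unfolding v grad_sq_matrix by (simp add: matrix_vector_mul_assoc inv inner_commute)
  finally have eq: "(\<Sum>i\<in>UNIV. \<Sum>j\<in>UNIV. G y $ i $ j * gradient G f y $ i * gradient G f y $ j) = grad_sq G f y" .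
  have "grad_sq G f y \<ge> 0"
    using metric_inverse_psd[OF assms] by (simp add: grad_sq_matrix inner_matrix_quad)
  then show ?thesis by (simp add: metric_norm_def eq)
qed

lemma riemannian_metric_matrix:
  "riemannian_metric \<A> S \<Longrightarrow> c \<in> \<A> \<Longrightarrow> y \<in> chart_image c \<Longrightarrow> metric_matrix (S c y)"
  unfolding riemannian_metric_def metric_matrix_def by blast

lemma grad_sq_chart_independent:
  fixes c d :: "('a, 'n::finite) chart"
  assumes X: "closed_manifold X \<A>" and S: "riemannian_metric \<A> S"
    and f: "\<And>c. c \<in> \<A> \<Longrightarrow> smooth_on (chart_image c) (local_rep f c)"
    and c: "c \<in> \<A>" and d: "d \<in> \<A>" and p: "p \<in> fst c" "p \<in> fst d"
  shows "grad_sq (S c) (local_rep f c) (snd c p) = grad_sq (S d) (local_rep f d) (snd d p)"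
proof -
  have cc: "is_chart X c" and cd: "is_chart X d"
    using X c d unfolding closed_manifold_def by auto
  let ?y = "snd c p" and ?z = "snd d p" and ?\<tau> = "transition c d"
  let ?W = "snd c ` (fst c \<inter> fst d)"
  have W: "open ?W" "?y \<in> ?W"
    using chart_open_image[OF cc chart_open[OF cd]] p by auto
  have z: "?z \<in> chart_image d" "?y \<in> chart_image c" using p by (auto simp: chart_image_def)
  define J :: "real^'n^'n" where "J = (\<chi> k i. jacobian c d ?y k i)"
  have \<tau>y: "?\<tau> ?y = ?z" by (simp add: transition_def chart_inv_chart[OF cc p(1)])
  have "ck_on (Suc 0) ?W ?\<tau>"
    using X c d unfolding closed_manifold_def smooth_on_def by blast
  then have "\<forall>x\<in>?W. ?\<tau> differentiable (at x within ?W)"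
    unfolding ck_on.simps by (rule conjunct1)
  then have "?\<tau> differentiable (at ?y within ?W)" using W(2) by (rule bspec)
  then have "?\<tau> differentiable (at ?y)" unfolding at_within_open[OF W(2,1)] .
  then obtain D where D: "(?\<tau> has_derivative D) (at ?y)" unfolding differentiable_def by blast
  have DJ: "D (axis i 1) $ k = J $ k $ i" for i k
  proof -
    have "((\<lambda>x. ?\<tau> x $ k) has_derivative (\<lambda>v. D v $ k)) (at ?y)"
      by (rule bounded_linear.has_derivative[OF bounded_linear_vec_nth D])
    then show ?thesis
      by (simp add: J_def jacobian_def pd_eq_dd dd_eqI)
  qed
  have fd: "local_rep f d differentiable (at ?z)"
    by (rule smooth_on_differentiable[OF chart_image_open[OF cd] f[OF d] z(1)])
  have grad: "pd i (local_rep f c) ?y = (\<Sum>k\<in>UNIV. J $ k $ i * pd k (local_rep f d) ?z)" for i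
  proof -
    have "pd i (local_rep f c) ?y = dd (axis i 1) (\<lambda>x. local_rep f d (?\<tau> x)) ?y"
      unfolding pd_eq_dd
      by (rule dd_cong_open[OF W])
        (auto simp: local_rep_def transition_def chart_inv_chart[OF cc] chart_inv_chart[OF cd])
    also have "\<dots> = dd (D (axis i 1)) (local_rep f d) ?z"
      using has_derivative_compose[OF D, of "local_rep f d" "\<lambda>v. dd v (local_rep f d) ?z"]
        has_derivative_dd[OF fd] by (intro dd_eqI) (simp add: \<tau>y)
    also have "\<dots> = (\<Sum>k\<in>UNIV. J $ k $ i * pd k (local_rep f d) ?z)"
      unfolding dd_eq_sum_pd[OF fd] DJ ..
    finally show ?thesis .
  qed
  have "S c ?y = transpose J ** S d ?z ** J"
  proof -
    have "S c ?y $ i $ j = (transpose J ** S d ?z ** J) $ i $ j" for i j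
    proof -
      have "S c ?y $ i $ j = (\<Sum>k\<in>UNIV. \<Sum>l\<in>UNIV. J $ k $ i * J $ l $ j * S d ?z $ k $ l)"
      proof -
        have "\<forall>c\<in>\<A>. \<forall>d\<in>\<A>. \<forall>p\<in>fst c \<inter> fst d. \<forall>i j. S c (snd c p) $ i $ j =
          (\<Sum>k\<in>UNIV. \<Sum>l\<in>UNIV. jacobian c d (snd c p) k i * jacobian c d (snd c p) l j * S d (snd d p) $ k $ l)"
          using S unfolding riemannian_metric_def tensor2_field_def by blast
        from this[rule_format, OF c d, of p i j] show ?thesis
          using p by (simp add: J_def)
      qed
      also have "\<dots> = (\<Sum>l\<in>UNIV. \<Sum>k\<in>UNIV. J $ k $ i * J $ l $ j * S d ?z $ k $ l)"
        by (rule sum.swap)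
      also have "\<dots> = (transpose J ** S d ?z ** J) $ i $ j"
        by (simp add: matrix_matrix_mult_def transpose_def sum_distrib_left sum_distrib_right mult_ac)
      finally show ?thesis .
    qed
    then show ?thesis by (simp add: vec_eq_iff)
  qed
  moreover have "(\<chi> i. pd i (local_rep f c) ?y) = transpose J *v (\<chi> k. pd k (local_rep f d) ?z)"
    by (simp add: vec_eq_iff matrix_vector_mult_def transpose_def grad)
  ultimately show ?thesis
    unfolding grad_sq_matrix
    by (intro inverse_congruence riemannian_metric_matrix[OF S c z(2)] riemannian_metric_matrix[OF S d z(1)])
qed

section \<open>Continuity up to the ends of the time interval\<close>

text \<open>
  The time interval \<open>I\<close> may contain its end points: the spatial derivatives of a slice are values of
  the derivative within \<open>V \<times> I\<close>, which is continuous there.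
\<close>

lemma continuous_on_grad_sq_family:
  fixes G :: "real \<Rightarrow> real^'n \<Rightarrow> real^'n^'n" and f :: "real \<Rightarrow> real^'n \<Rightarrow> real"
  assumes V: "open V"
    and G: "smooth_on (V \<times> I) (\<lambda>(y, t). G t y)" and f: "smooth_on (V \<times> I) (\<lambda>(y, t). f t y)"
    and metric: "\<And>y t. y \<in> V \<Longrightarrow> t \<in> I \<Longrightarrow> metric_matrix (G t y)"
  shows "continuous_on (V \<times> I) (\<lambda>(y, t). grad_sq (G t) (f t) y)"
proof -
  have Gc: "continuous_on (V \<times> I) (\<lambda>(y, t). G t y)"
    using G unfolding smooth_on_def by (metis ck_on.simps(1))
  have h: "continuous_on (V \<times> I) (\<lambda>z. ginv (G (snd z)) (fst z) i j)" for i j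
    unfolding ginv_def
    using Gc metric by (intro continuous_on_matrix_inv) (auto simp: case_prod_beta' intro: metric_matrix_invertible)
  let ?f = "\<lambda>(y, t). f t y"
  have "ck_on (Suc 0) (V \<times> I) ?f" using f unfolding smooth_on_def by blast
  then have d: "\<And>z. z \<in> V \<times> I \<Longrightarrow> ?f differentiable (at z within V \<times> I)"
    and c: "\<And>v. continuous_on (V \<times> I) (\<lambda>z. frechet_derivative ?f (at z within V \<times> I) v)"
    unfolding ck_on.simps by blast+
  have pd: "pd i (f t) y = frechet_derivative ?f (at (y, t) within V \<times> I) (axis i 1, 0)"
    if "y \<in> V" "t \<in> I" for i y t
    using slice_has_derivative[OF V that, of ?f] d[of "(y, t)"] that
    unfolding pd_eq_dd by (intro dd_eqI) simp
  have pdc: "continuous_on (V \<times> I) (\<lambda>z. pd i (f (snd z)) (fst z))" for i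
    by (rule continuous_on_cong[THEN iffD1, OF refl _ c[of "(axis i 1, 0)"]]) (auto simp: pd)
  show ?thesis
    unfolding grad_sq_def case_prod_beta' by (intro continuous_intros h pdc)
qed


lemma globalize_eq:
  assumes compat: "\<And>c d. c \<in> \<A> \<Longrightarrow> d \<in> \<A> \<Longrightarrow> p \<in> fst c \<Longrightarrow> p \<in> fst d \<Longrightarrow> F c (snd c p) = F d (snd d p)"
    and c: "c \<in> \<A>" "p \<in> fst c"
  shows "globalize \<A> F p = F c (snd c p)"
proof -
  have "(SOME c. c \<in> \<A> \<and> p \<in> fst c) \<in> \<A> \<and> p \<in> fst (SOME c. c \<in> \<A> \<and> p \<in> fst c)"
    by (rule someI[of "\<lambda>c. c \<in> \<A> \<and> p \<in> fst c" c]) (use c in simp)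
  then show ?thesis
    unfolding globalize_def Let_def using compat c by blast
qed

lemma continuous_map_globalize:
  fixes F :: "real \<Rightarrow> ('a, 'n::finite) chart \<Rightarrow> real^'n \<Rightarrow> real"
  assumes X: "closed_manifold X \<A>"
    and cont: "\<And>c. c \<in> \<A> \<Longrightarrow> continuous_on (chart_image c \<times> I) (\<lambda>(y, t). F t c y)"
    and compat: "\<And>t c d p. t \<in> I \<Longrightarrow> c \<in> \<A> \<Longrightarrow> d \<in> \<A> \<Longrightarrow> p \<in> fst c \<Longrightarrow> p \<in> fst d \<Longrightarrow>
      F t c (snd c p) = F t d (snd d p)"
  shows "continuous_map (prod_topology (top_of_set I) X) euclideanreal (\<lambda>(t, p). globalize \<A> (F t) p)"
proof (rule pasting_lemma[where I=\<A> and T="\<lambda>c. I \<times> fst c" and f="\<lambda>c (t, p). F t c (snd c p)"])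
  fix c assume c: "c \<in> \<A>"
  then have cc: "is_chart X c" using X unfolding closed_manifold_def by auto
  show "openin (prod_topology (top_of_set I) X) (I \<times> fst c)"
    using chart_open[OF cc] by (simp add: openin_prod_Times_iff)
  let ?P = "prod_topology (top_of_set I) (subtopology X (fst c))"
  have sub: "subtopology (prod_topology (top_of_set I) X) (I \<times> fst c) = ?P"
    by (simp add: subtopology_Times subtopology_subtopology)
  have "continuous_map ?P (prod_topology (top_of_set (chart_image c)) (top_of_set I)) (\<lambda>z. (snd c (snd z), fst z))"
    using continuous_map_compose[OF continuous_map_snd chart_continuous[OF cc]] continuous_map_fst
    by (intro continuous_map_pairedI) (auto simp: o_def)
  then have "continuous_map ?P (top_of_set (chart_image c \<times> I)) (\<lambda>z. (snd c (snd z), fst z))"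
    by simp
  from continuous_map_compose[OF this, of euclideanreal "\<lambda>(y, t). F t c y"] cont[OF c]
  show "continuous_map (subtopology (prod_topology (top_of_set I) X) (I \<times> fst c)) euclideanreal (\<lambda>(t, p). F t c (snd c p))"
    unfolding sub by (simp add: o_def case_prod_beta')
next
  fix c d z assume cd: "c \<in> \<A>" "d \<in> \<A>"
    and "z \<in> topspace (prod_topology (top_of_set I) X) \<inter> I \<times> fst c \<inter> I \<times> fst d"
  then have "fst z \<in> I" "snd z \<in> fst c" "snd z \<in> fst d" by auto
  from compat[OF this(1) cd this(2,3)]
  show "(case z of (t, p) \<Rightarrow> F t c (snd c p)) = (case z of (t, p) \<Rightarrow> F t d (snd d p))"
    by (simp add: case_prod_beta')
next
  fix z assume "z \<in> topspace (prod_topology (top_of_set I) X)"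
  then obtain t p where z: "z = (t, p)" "t \<in> I" "p \<in> topspace X" by auto
  then obtain c where c: "c \<in> \<A>" "p \<in> fst c" using X unfolding closed_manifold_def by blast
  have "globalize \<A> (F t) p = F t c (snd c p)"
    by (rule globalize_eq[where F="F t" and p=p, OF compat[OF z(2)] c])
  then show "\<exists>c. c \<in> \<A> \<and> z \<in> I \<times> fst c \<and>
      (case z of (t, p) \<Rightarrow> globalize \<A> (F t) p) = (case z of (t, p) \<Rightarrow> F t c (snd c p))"
    using z c by (intro exI[of _ c]) simp
qed

section \<open>The gradient estimate\<close>

text \<open>
  The hypotheses of the estimate, with \<open>A\<close> an upper bound for the initial values.
\<close>

locale heat_on_flow =
  fixes X :: "'a topology" and \<A> :: "('a, 'n::finite) chart set"
    and g :: "real \<Rightarrow> ('a, 'n) tensor2" and H :: "real \<Rightarrow> ('a, 'n) tensor3"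
    and u :: "real \<Rightarrow> 'a \<Rightarrow> real" and T A :: real
  assumes manifold: "closed_manifold X \<A>" and T: "T > 0"
    and flow: "generalized_ricci_flow X \<A> T g H"
    and heat: "heat_solution \<A> T g u"
    and pos: "\<And>t x. t \<in> {0..T} \<Longrightarrow> x \<in> topspace X \<Longrightarrow> u t x > 0"
    and le_A: "\<And>x. x \<in> topspace X \<Longrightarrow> u 0 x \<le> A"
begin

lemma chart: "c \<in> \<A> \<Longrightarrow> is_chart X c"
  using manifold unfolding closed_manifold_def by auto

lemma open_image: "c \<in> \<A> \<Longrightarrow> open (chart_image c)"
  using chart_image_open[OF chart] .

lemma chart_domain: "c \<in> \<A> \<Longrightarrow> p \<in> fst c \<Longrightarrow> p \<in> topspace X"
  using openin_subset[OF chart_open[OF chart]] by blast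

lemma metric: "t \<in> {0..T} \<Longrightarrow> c \<in> \<A> \<Longrightarrow> y \<in> chart_image c \<Longrightarrow> metric_matrix (g t c y)"
  using flow unfolding generalized_ricci_flow_def by (intro riemannian_metric_matrix) auto

lemma smooth_g: "c \<in> \<A> \<Longrightarrow> smooth_on (chart_image c \<times> {0..T}) (\<lambda>(y, t). g t c y)"
  using flow unfolding generalized_ricci_flow_def smooth_family_def by blast

lemma smooth_u: "c \<in> \<A> \<Longrightarrow> smooth_on (chart_image c \<times> {0..T}) (\<lambda>(y, t). local_rep (u t) c y)"
  using heat unfolding heat_solution_def smooth_family_def by blast

lemma u_pos: "t \<in> {0..T} \<Longrightarrow> c \<in> \<A> \<Longrightarrow> y \<in> chart_image c \<Longrightarrow> local_rep (u t) c y > 0"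
  unfolding chart_image_def by (auto simp only: local_rep_chart[OF chart] intro!: pos chart_domain)

text \<open>
  The function \<open>t |\<nabla>f|\<^sup>2 - f\<close> for \<open>f = ln (A / u)\<close> in the chart \<open>c\<close>. It is written in terms of \<open>u\<close>,
  whose smoothness up to the ends of the time interval then gives continuity there.
\<close>

definition \<Phi> :: "real \<Rightarrow> ('a, 'n) chart \<Rightarrow> real^'n \<Rightarrow> real" where
  "\<Phi> t c y = t * (grad_sq (g t c) (local_rep (u t) c) y / (local_rep (u t) c y)\<^sup>2)
     - (ln A - ln (local_rep (u t) c y))"

lemma continuous_on_\<Phi>:
  assumes c: "c \<in> \<A>"
  shows "continuous_on (chart_image c \<times> {0..T}) (\<lambda>(y, t). \<Phi> t c y)"
proof -
  have "continuous_on (chart_image c \<times> {0..T}) (\<lambda>(y, t). grad_sq (g t c) (local_rep (u t) c) y)"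
    by (rule continuous_on_grad_sq_family[OF open_image[OF c] smooth_g[OF c] smooth_u[OF c]])
      (rule metric[OF _ c])
  moreover have "continuous_on (chart_image c \<times> {0..T}) (\<lambda>(y, t). local_rep (u t) c y)"
    using smooth_u[OF c] unfolding smooth_on_def by (metis ck_on.simps(1))
  moreover have "\<forall>z \<in> chart_image c \<times> {0..T}. local_rep (u (snd z)) c (fst z) \<noteq> 0"
    using u_pos[OF _ c] by force
  ultimately show ?thesis
    unfolding \<Phi>_def case_prod_beta' by (intro continuous_intros) auto
qed

lemma \<Phi>_compatible:
  assumes t: "t \<in> {0..T}" and c: "c \<in> \<A>" "d \<in> \<A>" and p: "p \<in> fst c" "p \<in> fst d"
  shows "\<Phi> t c (snd c p) = \<Phi> t d (snd d p)"
proof -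
  have "grad_sq (g t c) (local_rep (u t) c) (snd c p) = grad_sq (g t d) (local_rep (u t) d) (snd d p)"
  proof (rule grad_sq_chart_independent[OF manifold _ _ c p])
    show "riemannian_metric \<A> (g t)" using flow t unfolding generalized_ricci_flow_def by blast
    show "smooth_on (chart_image c) (local_rep (u t) c)" if "c \<in> \<A>" for c
      using smooth_on_slice[OF open_image[OF that] t smooth_u[OF that]] by simp
  qed
  then show ?thesis
    by (simp add: \<Phi>_def local_rep_chart[OF chart] c p)
qed

text \<open>
  Independence of the chart (\<open>\<Phi>_compatible\<close>) makes this a continuous function on \<open>X\<close>, to which the
  maximum principle applies.
\<close>

definition \<Psi> :: "real \<Rightarrow> 'a \<Rightarrow> real" where
  "\<Psi> t = globalize \<A> (\<Phi> t)"

lemma \<Psi>_chart: "t \<in> {0..T} \<Longrightarrow> c \<in> \<A> \<Longrightarrow> p \<in> fst c \<Longrightarrow> \<Psi> t p = \<Phi> t c (snd c p)"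
  unfolding \<Psi>_def by (rule globalize_eq[where F="\<Phi> t" and p=p, OF \<Phi>_compatible])

text \<open>
  The chart-level evolution inequality, transferred to \<open>\<Psi>\<close>: the maximum over \<open>X\<close> is in particular
  one over the image of a chart around \<open>p\<close>.
\<close>

lemma \<Psi>_decreases_at_spatial_max:
  assumes t: "0 < t" "t < T" and p: "p \<in> topspace X"
    and max: "\<And>q. q \<in> topspace X \<Longrightarrow> \<Psi> t q \<le> \<Psi> t p"
  shows "\<exists>D \<le> 0. ((\<lambda>s. \<Psi> s p) has_real_derivative D) (at t)"
proof -
  obtain c where c: "c \<in> \<A>" "p \<in> fst c" using p manifold unfolding closed_manifold_def by blast
  define V where "V = chart_image c"
  define I where "I = {0<..<T}"
  define y where "y = snd c p"
  define U where "U = (\<lambda>t. local_rep (u t) c)"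
  define f where "f = (\<lambda>t y. ln A - ln (U t y))"
  have V: "open V" and I: "open I" and y: "y \<in> V" and tI: "t \<in> I" and I_sub: "\<And>s. s \<in> I \<Longrightarrow> s \<in> {0..T}"
    using open_image[OF c(1)] c t by (auto simp: V_def I_def y_def chart_image_def)
  have S: "open (V \<times> I)" using V I by (rule open_Times)
  have sub: "V \<times> I \<subseteq> chart_image c \<times> {0..T}" using I_sub by (auto simp: V_def)
  have metric_c: "metric_matrix (g s c z)" if "z \<in> V" "s \<in> I" for s z
    using metric[OF I_sub[OF that(2)] c(1)] that by (simp add: V_def)
  have gs: "smooth_on (V \<times> I) (\<lambda>(y, t). g t c y $ i $ j)" for i j
    using smooth_on_vec_nth[OF S smooth_on_vec_nth[OF S smooth_on_open_subset[OF S sub smooth_g[OF c(1)]], of i], of j]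
    by (simp add: case_prod_beta')
  have Us: "smooth_on (V \<times> I) (\<lambda>(y, t). U t y)"
    using smooth_on_open_subset[OF S sub smooth_u[OF c(1)]] by (simp add: U_def)
  have Upos: "U s z > 0" if "z \<in> V" "s \<in> I" for s z
    using u_pos[OF I_sub[OF that(2)] c(1)] that by (simp add: U_def V_def)
  have fs: "smooth_on (V \<times> I) (\<lambda>(y, t). f t y)"
  proof -
    have "smooth_on (V \<times> I) (\<lambda>z. ln ((\<lambda>(y, t). U t y) z))"
      by (rule smooth_on_ln[OF S Us]) (use Upos in auto)
    then have "smooth_on (V \<times> I) (\<lambda>z. ln A - ln ((\<lambda>(y, t). U t y) z))"
      by (intro smooth_on_diff smooth_on_const S)
    then show ?thesis by (simp add: f_def case_prod_beta')
  qed
  have mc: "metric_chart V (g s c)" if "s \<in> I" for s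
    using V smooth_on_slice[OF V that gs] metric_c[OF _ that] by unfold_locales auto
  have U_slice: "smooth_on V (U s)" if "s \<in> I" for s
    using smooth_on_slice[OF V that Us] by simp
  note log = metric_chart.log_transform[OF mc _ U_slice Upos, where L="ln A"]
  have \<Phi>_f: "\<Phi> s c z = s * grad_sq (g s c) (f s) z - f s z" if "z \<in> V" "s \<in> I" for s z
    using log(2)[OF that(2) that(1) that(2) _ that(2)] that
    by (simp add: \<Phi>_def f_def U_def)
  let ?\<psi> = "\<lambda>z. t * grad_sq (g t c) (f t) z - f t z"
  interpret metric_chart V "g t c" by (rule mc[OF tI])
  have ft: "smooth_on V (f t)" using smooth_on_slice[OF V tI fs] by simp
  have \<psi>s: "smooth_on V ?\<psi>" by (intro smooth_intros V smooth_grad_sq ft)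
  have \<psi>max: "?\<psi> z \<le> ?\<psi> y" if z: "z \<in> V" for z
  proof -
    obtain q where q: "q \<in> fst c" "z = snd c q" using z unfolding V_def chart_image_def by blast
    have "\<Phi> t c z \<le> \<Phi> t c y"
      using max[OF chart_domain[OF c(1) q(1)]] \<Psi>_chart[OF I_sub[OF tI] c(1)] q c(2) by (simp add: y_def)
    then show ?thesis using \<Phi>_f[OF z tI] \<Phi>_f[OF y tI] by simp
  qed
  have at: "at t within {0..T} = at t"
    using t by (intro at_within_interior) simp
  have "\<exists>D. ((\<lambda>s. s * grad_sq (g s c) (f s) y - f s y) has_real_derivative D) (at t) \<and>
    D \<le> (\<Sum>i\<in>UNIV. \<Sum>j\<in>UNIV. ginv (g t c) y i j * pd i (pd j ?\<psi>) y)"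
  proof (rule evolution_at_critical_point[OF V I y tI t(1) gs metric_c fs,
        where K="\<lambda>i j. three_form_sq (g t c) (H t c) y $ i $ j"])
    fix i j
    have "((\<lambda>s. g s c y) has_vector_derivative
        (- 2 *\<^sub>R ricci (g t c) y + (1/2) *\<^sub>R three_form_sq (g t c) (H t c) y)) (at t)"
      using flow c y I_sub[OF tI] unfolding generalized_ricci_flow_def at[symmetric] V_def by blast
    from bounded_linear.has_vector_derivative[OF bounded_linear_vec_nth[of j]
        bounded_linear.has_vector_derivative[OF bounded_linear_vec_nth[of i] this]]
    show "((\<lambda>s. g s c y $ i $ j) has_real_derivative
        - 2 * ricci (g t c) y $ i $ j + (1/2) * three_form_sq (g t c) (H t c) y $ i $ j) (at t)"
      by (simp add: has_real_derivative_iff_has_vector_derivative)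
  next
    show "quad (\<lambda>i j. three_form_sq (g t c) (H t c) y $ i $ j) v \<ge> 0" for v
      by (rule three_form_sq_psd[OF y])
  next
    fix z assume z: "z \<in> V"
    then obtain q where q: "q \<in> fst c" "z = snd c q" unfolding V_def chart_image_def by blast
    have Uq: "U s z = u s q" for s by (simp add: U_def q local_rep_chart[OF chart[OF c(1)]])
    have "((\<lambda>s. u s q) has_real_derivative laplacian (g t c) (U t) z) (at t)"
      using heat c(1) q I_sub[OF tI] unfolding heat_solution_def at[symmetric] U_def by blast
    then have "((\<lambda>s. ln A - ln (U s z)) has_real_derivative 0 - 1 / U t z * laplacian (g t c) (U t) z) (at t)"
      using Upos[OF z tI] unfolding Uq by (intro DERIV_diff DERIV_const DERIV_chain2[OF DERIV_ln_divide]) auto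
    moreover have "0 - 1 / U t z * laplacian (g t c) (U t) z
        = laplacian (g t c) (f t) z - grad_sq (g t c) (f t) z"
      using log(2,3)[OF tI z tI _ tI] by (simp add: f_def)
    ultimately show "((\<lambda>s. f s z) has_real_derivative laplacian (g t c) (f t) z - grad_sq (g t c) (f t) z) (at t)"
      unfolding f_def by simp
  next
    show "pd k ?\<psi> y = 0" for k
      unfolding pd_eq_dd by (rule dd_at_local_max[OF V y differentiable_V[OF y \<psi>s] \<psi>max])
  qed
  then obtain D where D: "((\<lambda>s. s * grad_sq (g s c) (f s) y - f s y) has_real_derivative D) (at t)"
    and "D \<le> (\<Sum>i\<in>UNIV. \<Sum>j\<in>UNIV. ginv (g t c) y i j * pd i (pd j ?\<psi>) y)" by blast
  then have "D \<le> 0"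
    using trace_hessian_at_local_max[OF y \<psi>s \<psi>max] by linarith
  moreover have "((\<lambda>s. \<Psi> s p) has_real_derivative D) (at t)"
  proof (rule has_field_derivative_transform_within_open[OF D I tI])
    show "s * grad_sq (g s c) (f s) y - f s y = \<Psi> s p" if "s \<in> I" for s
      using \<Phi>_f[OF y that] \<Psi>_chart[OF I_sub[OF that] c] by (simp add: y_def)
  qed
  ultimately show ?thesis by blast
qed

lemma \<Psi>_nonpos_before_end:
  assumes t: "0 \<le> t" "t < T" and p: "p \<in> topspace X"
  shows "\<Psi> t p \<le> 0"
proof -
  define T' where "T' = (t + T) / 2"
  have T': "0 < T'" "t \<le> T'" "T' < T" using t by (auto simp: T'_def)
  show ?thesis
  proof (rule weak_maximum_principle[of X T' \<Psi>])
    show "compact_space X" using manifold unfolding closed_manifold_def by blast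
    show "continuous_map (prod_topology (top_of_set {0..T'}) X) euclideanreal (\<lambda>(t, p). \<Psi> t p)"
      unfolding \<Psi>_def
    proof (rule continuous_map_globalize[OF manifold])
      show "continuous_on (chart_image c \<times> {0..T'}) (\<lambda>(y, t). \<Phi> t c y)" if "c \<in> \<A>" for c
        by (rule continuous_on_subset[OF continuous_on_\<Phi>[OF that]]) (use T' in auto)
    qed (use T' in \<open>auto intro: \<Phi>_compatible\<close>)
    show "\<Psi> 0 q \<le> 0" if q: "q \<in> topspace X" for q
    proof -
      obtain c where c: "c \<in> \<A>" "q \<in> fst c" using q manifold unfolding closed_manifold_def by blast
      have "u 0 q > 0" "u 0 q \<le> A" using pos[of 0 q] T q le_A by auto
      then have "ln (u 0 q) \<le> ln A" by simp
      then show ?thesis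
        using \<Psi>_chart[of 0, OF _ c] T by (simp add: \<Phi>_def local_rep_chart[OF chart] c)
    qed
    show "\<exists>D\<le>0. ((\<lambda>s. \<Psi> s q) has_real_derivative D) (at s)"
      if "0 < s" "s \<le> T'" "q \<in> topspace X" "\<And>r. r \<in> topspace X \<Longrightarrow> \<Psi> s r \<le> \<Psi> s q" for s q
      by (rule \<Psi>_decreases_at_spatial_max) (use that T' in auto)
  qed (use T' t p in auto)
qed

lemma \<Phi>_nonpos:
  assumes t: "t \<in> {0..T}" and c: "c \<in> \<A>" "p \<in> fst c"
  shows "\<Phi> t c (snd c p) \<le> 0"
proof (rule continuous_le_on_closure[where S="{0..<T}" and f="\<lambda>t. \<Phi> t c (snd c p)"])
  have "continuous_on {0..T} ((\<lambda>(y, t). \<Phi> t c y) \<circ> (\<lambda>t. (snd c p, t)))"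
    using c by (intro continuous_on_compose continuous_intros continuous_on_subset[OF continuous_on_\<Phi>])
      (auto simp: chart_image_def)
  then show "continuous_on (closure {0..<T}) (\<lambda>t. \<Phi> t c (snd c p))"
    using T by (simp add: o_def)
  show "t \<in> closure {0..<T}" using t T by simp
  show "\<Phi> s c (snd c p) \<le> 0" if "s \<in> {0..<T}" for s
    using \<Psi>_nonpos_before_end[of s p] \<Psi>_chart[of s c p] chart_domain that c by auto
qed

end

theorem theorem1p7:
  fixes X :: "'a topology" and \<A> :: "('a, 'n::finite) chart set"
    and g :: "real \<Rightarrow> ('a, 'n) tensor2" and H :: "real \<Rightarrow> ('a, 'n) tensor3"
    and u :: "real \<Rightarrow> 'a \<Rightarrow> real" and T A :: real
  assumes "closed_manifold X \<A>"
    and "T > 0"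
    and "generalized_ricci_flow X \<A> T g H"
    and "heat_solution \<A> T g u"
    and "\<forall>t\<in>{0..T}. \<forall>x\<in>topspace X. u t x > 0"
    and "A \<in> u 0 ` topspace X" and "\<forall>x\<in>topspace X. u 0 x \<le> A"
  shows "\<forall>x\<in>topspace X. \<forall>t\<in>{0<..T}. \<forall>c\<in>\<A>. x \<in> fst c \<longrightarrow>
    (metric_norm (g t c) (snd c x) (gradient (g t c) (local_rep (u t) c) (snd c x)))\<^sup>2
      \<le> (u t x)\<^sup>2 / t * ln (A / u t x)"
proof (intro ballI impI)
  fix x t c assume x: "x \<in> topspace X" and t: "t \<in> {0<..T}" and c: "c \<in> \<A>" "x \<in> fst c"
  interpret heat_on_flow X \<A> g H u T A
    using assms by unfold_locales auto
  have t': "t \<in> {0..T}" "t > 0" using t by auto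
  have u: "u t x > 0" by (rule pos[OF t'(1) x])
  have A: "A > 0" using assms(6) pos[of 0] T by auto
  let ?N = "grad_sq (g t c) (local_rep (u t) c) (snd c x)"
  have "snd c x \<in> chart_image c" using c by (simp add: chart_image_def)
  then have "(metric_norm (g t c) (snd c x) (gradient (g t c) (local_rep (u t) c) (snd c x)))\<^sup>2 = ?N"
    by (intro metric_norm_gradient metric t' c)
  moreover have "t * (?N / (u t x)\<^sup>2) \<le> ln (A / u t x)"
    using \<Phi>_nonpos[OF t'(1) c] A u by (simp add: \<Phi>_def local_rep_chart[OF chart] c ln_div)
  then have "?N \<le> (u t x)\<^sup>2 / t * ln (A / u t x)"
    using t'(2) u by (simp add: field_simps)
  ultimately show "(metric_norm (g t c) (snd c x) (gradient (g t c) (local_rep (u t) c) (snd c x)))\<^sup>2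
      \<le> (u t x)\<^sup>2 / t * ln (A / u t x)" by simp
qed

end
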